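(* Consider estimating a scale mixture of normals density $q(t-\mu)$, $t\in\mathbb{R}^p$, with $q\sim SN_p(H)$, under integrated $L_2$ loss, based on $X$ with $X-\mu\sim SN_p(G)$, $\mu\in\mathbb{R}^p$. For $c\ge1$ let $\hat q_c(y;x)=\frac{1}{c^p}\,q\left(\frac{y-x}{c}\right)$. Let $W_1,W_2\sim H$ and $V_1\sim G$ be independently distributed, and define $M_c=E[(V_1+W_1+c^2W_2)^{-p/2}]$ for $c\ge1$, and $N=E[(W_1+W_2)^{-p/2}]$. (a) The risk $R(\mu,\hat q_c)$ is constant in $\mu$ and given by $$R(\mu,\hat q_c)=\frac{1}{(2\pi)^{p/2}}\left(\Big(1+\frac{1}{c^p}\Big)N-2M_c\right).$$ (b) The optimal estimator among the class of estimators $\hat q_c$ is $\hat q_{c^*}$, where $c^*$ is the unique value of $c>1$ such that $$2\,c^{p+2}\,E\left[\frac{W_2}{(V_1+W_1+c^2W_2)^{p/2+1}}\right]=N .$$ (c) Estimators $\hat q_c$ with $1<c<c_1$ dominate the plug-in $\hat q_1$, where $c_1=\infty$ if $N\ge2M_1$ and, otherwise, $c_1$ is the unique value of $c>1$ such that $N\left(1-\frac{1}{c^p}\right)=2(M_1-M_c)$.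
   Context: A density $p_X$ on $\mathbb{R}^p$ is a scale mixture of normals, written $SN_p(G)$, if $p_X(x)=\int_{\mathbb{R}_+}(2\pi v)^{-p/2}e^{-\|x\|^2/(2v)}\,dG(v)$ for a cdf $G$ on $\mathbb{R}_+$. It is further assumed that $E(V^{-p/2})<\infty$ for $V\sim G$ and $E(W^{-p/2})<\infty$ for $W\sim H$ (this implies that $M_c$ and $N$ are finite). The integrated $L_2$ loss of an estimate $\hat q(\cdot;x)$ is $\int_{\mathbb{R}^p}(q(y-\mu)-\hat q(y;x))^2\,dy$; $R(\mu,\hat q)$ is its expectation over $X$. One estimator dominates another if its risk is $\le$ for all $\mu$ with strict inequality for some $\mu$. "Optimal" means having the smallest (constant) risk. *)

theory Defs
  imports "HOL-Probability.Probability"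
begin

text \<open>
  A cdf on the positive half-line is represented by the corresponding probability measure on
  \<^typ>\<open>real\<close>. Positivity is strict: an atom at 0 is incompatible with the condition
  $E(V^{-p/2}) < \infty$, but this has to be said explicitly since \<open>0 powr a = 0\<close>.
\<close>

definition mixing_law :: "real measure \<Rightarrow> bool" where
  "mixing_law G \<longleftrightarrow> real_distribution G \<and> (AE v in G. 0 < v)"

definition sn_density :: "real measure \<Rightarrow> 'a::euclidean_space \<Rightarrow> real" where
  "sn_density G x =
     (\<integral>v. (2 * pi * v) powr (- real DIM('a) / 2) * exp (- (norm x)\<^sup>2 / (2 * v)) \<partial>G)"

text \<open>
  An estimator is a function \<open>qh\<close> of the point \<open>y\<close> and the observation \<open>x\<close>, in this order.
  Loss and risk are extended-valued, so that a divergent integral counts as infinite.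
  In \<open>l2_risk\<close>, \<open>P \<mu>\<close> is the underlying probability measure when the parameter is \<open>\<mu>\<close>.
\<close>

definition l2_loss :: "('a::euclidean_space \<Rightarrow> real) \<Rightarrow> 'a \<Rightarrow> ('a \<Rightarrow> real) \<Rightarrow> ennreal" where
  "l2_loss q \<mu> f = (\<integral>\<^sup>+ y. ennreal ((q (y - \<mu>) - f y)\<^sup>2) \<partial>lborel)"

definition l2_risk :: "('a::euclidean_space \<Rightarrow> 's measure) \<Rightarrow> ('s \<Rightarrow> 'a) \<Rightarrow> ('a \<Rightarrow> real)
    \<Rightarrow> 'a \<Rightarrow> ('a \<Rightarrow> 'a \<Rightarrow> real) \<Rightarrow> ennreal" where
  "l2_risk P X q \<mu> qh = (\<integral>\<^sup>+ s. l2_loss q \<mu> (\<lambda>y. qh y (X s)) \<partial>P \<mu>)"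

definition qhat :: "('a::euclidean_space \<Rightarrow> real) \<Rightarrow> real \<Rightarrow> 'a \<Rightarrow> 'a \<Rightarrow> real" where
  "qhat q c y x = 1 / c ^ DIM('a) * q ((y - x) /\<^sub>R c)"

definition dominates :: "('p \<Rightarrow> 'e \<Rightarrow> ennreal) \<Rightarrow> 'e \<Rightarrow> 'e \<Rightarrow> bool" where
  "dominates R a b \<longleftrightarrow> (\<forall>\<mu>. R \<mu> a \<le> R \<mu> b) \<and> (\<exists>\<mu>. R \<mu> a < R \<mu> b)"

definition optimal_among :: "('p \<Rightarrow> 'e \<Rightarrow> ennreal) \<Rightarrow> 'e set \<Rightarrow> 'e \<Rightarrow> bool" where
  "optimal_among R C a \<longleftrightarrow> a \<in> C \<and> (\<forall>b\<in>C. \<forall>\<mu>. R \<mu> a \<le> R \<mu> b)"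

end

theory Submission imports Defs begin

text \<open>
  Let \<open>d\<close> be the dimension and \<open>k = d/2\<close>.

  The risk formula is a computation with convolutions. Since \<open>\<phi>\<^sub>a * \<phi>\<^sub>b = \<phi>\<^sub>a\<^sub>+\<^sub>b\<close> for centred normal
  densities, the convolution of two scale mixtures of normals is a scale mixture over the product of
  the mixing spaces, with the variances added (\<open>nn_integral_normal_mixture_mult\<close>). Multiplying out
  the square in the loss gives three integrals; after averaging over \<open>X\<close> each is such a mixture at the
  point \<open>0\<close>, that is \<open>(2\<pi>)\<^sup>-\<^sup>k\<close> times the \<open>-k\<close>th moment of a sum of mixing variables: of
  \<open>W\<^sub>1 + W\<^sub>2\<close>, of \<open>c\<^sup>2 (W\<^sub>1 + W\<^sub>2)\<close>, and of \<open>V\<^sub>1 + W\<^sub>1 + c\<^sup>2 W\<^sub>2\<close> for the cross term (\<open>l2_risk_qhat\<close>).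

  For the comparison of scales put \<open>t = c\<^sup>-\<^sup>d\<close>, which ranges over \<open>(0, 1]\<close>. Then
  \<open>M\<^sub>c = E[t ((V\<^sub>1 + W\<^sub>1) t\<^sup>1\<^sup>/\<^sup>k + W\<^sub>2)\<^sup>-\<^sup>k] = \<Phi> t\<close>, and \<open>\<Phi>\<close> is strictly concave on all of
  \<open>[0, 1]\<close>, with \<open>\<Phi> 0 = 0\<close>. So, up to a constant factor, the risk is the strictly convex function
  \<open>F t = (1 + t) N - 2 \<Phi> t\<close>, with derivative \<open>N - 2 \<Phi>' t\<close>, and the optimal scale and the range of
  domination are read off from its shape. The derivative is negative at \<open>0\<close>, because \<open>\<Phi>' 0 = E[W\<^sub>2\<^sup>-\<^sup>k] > N\<close>, and positive at
  \<open>1\<close>, because \<open>2 \<Phi>' 1 < N\<close> by exchangeability of \<open>W\<^sub>1\<close> and \<open>W\<^sub>2\<close>. Hence there is exactly one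
  critical point, it is interior, and it is the strict minimum: \<open>2 \<Phi>' t = N\<close> is the equation for
  the optimal scale. The end values are \<open>F 0 = N\<close> and \<open>F 1 = 2 N - 2 M\<^sub>1\<close>. If \<open>N \<ge> 2 M\<^sub>1\<close>, then \<open>F 0 \<le> F 1\<close> and
  convexity puts \<open>F\<close> below \<open>F 1\<close> throughout \<open>(0, 1)\<close>; otherwise \<open>F\<close> meets the level \<open>F 1\<close> at exactly
  one point of \<open>(0, 1)\<close> and is below it from there up to \<open>1\<close>. As \<open>F (c\<^sup>-\<^sup>d) < F 1\<close> is domination of the plug-in, this
  gives \<open>c\<^sub>1\<close>.

  Differentiation under the integral is avoided: the tangent inequality
  \<open>\<Phi> s - \<Phi> t \<le> \<Phi>' t (s - t)\<close>, obtained pointwise and integrated, together with strict monotonicity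
  and continuity of \<open>\<Phi>'\<close>, carries the argument (\<open>strictly_convex_unit_interval\<close>).
\<close>

section \<open>Normal densities and their convolution\<close>

text \<open>
  The density of the centred normal law with covariance \<open>v\<close> times the identity.
\<close>

definition gauss :: "real \<Rightarrow> 'a::euclidean_space \<Rightarrow> real" where
  "gauss v x = (2 * pi * v) powr (- real DIM('a) / 2) * exp (- (norm x)\<^sup>2 / (2 * v))"

lemma gauss_nonneg: "0 \<le> gauss v x"
  by (simp add: gauss_def)

lemma measurable_gauss [measurable]:
  fixes g :: "'b \<Rightarrow> 'a::euclidean_space"
  assumes [measurable]: "f \<in> borel_measurable M" "g \<in> borel_measurable M"
  shows "(\<lambda>w. gauss (f w) (g w)) \<in> borel_measurable M"
  unfolding gauss_def by measurable

lemma nn_integral_gaussian_exp: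
  assumes v: "0 < v"
  shows "(\<integral>\<^sup>+(x::'a::euclidean_space). ennreal (exp (- (norm x)\<^sup>2 / (2 * v))) \<partial>lborel)
    = ennreal ((2 * pi * v) powr (real DIM('a) / 2))"
proof -
  have one_dim: "(\<integral>\<^sup>+(t::real). ennreal (exp (- t\<^sup>2 / (2 * v))) \<partial>lborel) = ennreal (sqrt (2 * pi * v))"
  proof -
    have "(\<integral>\<^sup>+(t::real). ennreal (exp (- t\<^sup>2 / (2 * v))) \<partial>lborel)
      = (\<integral>\<^sup>+(t::real). ennreal (sqrt (2 * pi * v)) * ennreal (normal_density 0 (sqrt v) t) \<partial>lborel)"
      using v by (intro nn_integral_cong) (simp add: normal_density_def ennreal_mult[symmetric])
    also have "\<dots> = ennreal (sqrt (2 * pi * v)) * (\<integral>\<^sup>+(t::real). ennreal (normal_density 0 (sqrt v) t) \<partial>lborel)"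
      by (rule nn_integral_cmult) simp
    also have "(\<integral>\<^sup>+(t::real). ennreal (normal_density 0 (sqrt v) t) \<partial>lborel) = 1"
      using v by (subst nn_integral_eq_integral) auto
    finally show ?thesis by simp
  qed
  have "(\<integral>\<^sup>+(x::'a). ennreal (exp (- (norm x)\<^sup>2 / (2 * v))) \<partial>lborel)
    = (\<integral>\<^sup>+(x::'a). (\<Prod>b\<in>Basis. ennreal (exp (- (x \<bullet> b)\<^sup>2 / (2 * v)))) \<partial>lborel)"
  proof (intro nn_integral_cong)
    fix x :: 'a
    have "(norm x)\<^sup>2 = (\<Sum>b\<in>Basis. (x \<bullet> b)\<^sup>2)"
      unfolding power2_norm_eq_inner by (subst euclidean_inner) (simp only: power2_eq_square)
    then show "ennreal (exp (- (norm x)\<^sup>2 / (2 * v))) = (\<Prod>b\<in>Basis. ennreal (exp (- (x \<bullet> b)\<^sup>2 / (2 * v))))"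
      by (simp add: prod_ennreal exp_sum[symmetric] sum_negf sum_divide_distrib)
  qed
  also have "\<dots> = (\<Prod>b\<in>(Basis::'a set). \<integral>\<^sup>+(t::real). ennreal (exp (- t\<^sup>2 / (2 * v))) \<partial>lborel)"
    by (rule nn_integral_lborel_prod) auto
  also have "\<dots> = ennreal (sqrt (2 * pi * v) ^ DIM('a))"
    unfolding one_dim using v by (simp add: ennreal_power)
  also have "sqrt (2 * pi * v) ^ DIM('a) = (2 * pi * v) powr (real DIM('a) / 2)"
    using v by (simp add: powr_half_sqrt[symmetric] powr_powr powr_realpow[symmetric])
  finally show ?thesis .
qed

text \<open>
  The convolution semigroup of normal densities. Completing the square splits the exponent into a
  Gaussian in \<open>y\<close>, centred at the precision-weighted mean \<open>z\<close> of \<open>m\<close> and \<open>m'\<close> and of variance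
  \<open>a b / (a + b)\<close>, and a term in \<open>m - m'\<close> of variance \<open>a + b\<close>.
\<close>

lemma nn_integral_gauss_mult_gauss:
  fixes m m' :: "'a::euclidean_space"
  assumes a: "0 < a" and b: "0 < b"
  shows "(\<integral>\<^sup>+y. ennreal (gauss a (y - m)) * ennreal (gauss b (y - m')) \<partial>lborel)
    = ennreal (gauss (a + b) (m - m'))"
proof -
  define k where "k = real DIM('a) / 2"
  define v where "v = a * b / (a + b)"
  define z where "z = m - (a / (a + b)) *\<^sub>R (m - m')"
  have v: "0 < v" using a b by (simp add: v_def)
  define C where "C = (2 * pi * a) powr - k * (2 * pi * b) powr - k * exp (- (norm (m - m'))\<^sup>2 / (2 * (a + b)))"
  have sq: "(norm (z + y - m))\<^sup>2 / (2 * a) + (norm (z + y - m'))\<^sup>2 / (2 * b)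
      = (norm y)\<^sup>2 / (2 * v) + (norm (m - m'))\<^sup>2 / (2 * (a + b))" for y
  proof -
    define u where "u = m - m'"
    have 1: "z + y - m = y - (a / (a + b)) *\<^sub>R u"
      by (simp add: z_def u_def)
    have "b / (a + b) = 1 - a / (a + b)" using a b by (simp add: field_simps)
    then have 2: "z + y - m' = y + (b / (a + b)) *\<^sub>R u"
      by (simp only: scaleR_diff_left) (simp add: z_def u_def)
    have e1: "(norm (y - (a / (a + b)) *\<^sub>R u))\<^sup>2 = y \<bullet> y - 2 * (a / (a + b)) * (y \<bullet> u) + (a / (a + b))\<^sup>2 * (u \<bullet> u)"
      unfolding power2_norm_eq_inner by (simp add: inner_diff inner_commute power2_eq_square algebra_simps)
    have e2: "(norm (y + (b / (a + b)) *\<^sub>R u))\<^sup>2 = y \<bullet> y + 2 * (b / (a + b)) * (y \<bullet> u) + (b / (a + b))\<^sup>2 * (u \<bullet> u)"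
      unfolding power2_norm_eq_inner by (simp add: inner_add inner_commute power2_eq_square algebra_simps)
    have "(x - 2 * (a / (a + b)) * p + (a / (a + b))\<^sup>2 * r) / (2 * a)
        + (x + 2 * (b / (a + b)) * p + (b / (a + b))\<^sup>2 * r) / (2 * b)
      = x / (2 * v) + r / (2 * (a + b))" for x p r :: real
    proof -
      have s: "a + b \<noteq> 0" using a b by simp
      have "(x - 2 * (a / (a + b)) * p + (a / (a + b))\<^sup>2 * r) / (2 * a)
        = x / (2 * a) - p / (a + b) + a * (r / (2 * (a + b)\<^sup>2))"
        using a s by (simp add: diff_divide_distrib add_divide_distrib power_divide power2_eq_square)
      moreover have "(x + 2 * (b / (a + b)) * p + (b / (a + b))\<^sup>2 * r) / (2 * b)
        = x / (2 * b) + p / (a + b) + b * (r / (2 * (a + b)\<^sup>2))"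
        using b s by (simp add: diff_divide_distrib add_divide_distrib power_divide power2_eq_square)
      moreover have "x / (2 * a) + x / (2 * b) = x / (2 * v)"
        using a b s by (simp add: v_def field_simps)
      moreover have "a * (r / (2 * (a + b)\<^sup>2)) + b * (r / (2 * (a + b)\<^sup>2)) = r / (2 * (a + b))"
      proof -
        have "l * (r / (2 * l\<^sup>2)) = r / (2 * l)" if "l \<noteq> 0" for l :: real
          using that by (simp add: power2_eq_square)
        from this[OF s] show ?thesis by (simp only: distrib_right)
      qed
      ultimately show ?thesis by linarith
    qed
    then show ?thesis
      unfolding 1 2 e1 e2 u_def[symmetric] unfolding power2_norm_eq_inner by blast
  qed
  have "(\<integral>\<^sup>+y. ennreal (gauss a (y - m)) * ennreal (gauss b (y - m')) \<partial>lborel)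
    = (\<integral>\<^sup>+y. ennreal (gauss a (z + y - m)) * ennreal (gauss b (z + y - m')) \<partial>lborel)"
    by (subst lborel_distr_plus[of z, symmetric]) (simp add: nn_integral_distr)
  also have "\<dots> = (\<integral>\<^sup>+(y::'a). ennreal C * ennreal (exp (- (norm y)\<^sup>2 / (2 * v))) \<partial>lborel)"
  proof (intro nn_integral_cong)
    fix y :: 'a
    have "exp (- (norm (z + y - m))\<^sup>2 / (2 * a)) * exp (- (norm (z + y - m'))\<^sup>2 / (2 * b))
      = exp (- (norm (m - m'))\<^sup>2 / (2 * (a + b))) * exp (- (norm y)\<^sup>2 / (2 * v))"
      using sq[of y] by (simp add: exp_add[symmetric] minus_divide_left[symmetric] del: minus_divide_left)
    then show "ennreal (gauss a (z + y - m)) * ennreal (gauss b (z + y - m'))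
      = ennreal C * ennreal (exp (- (norm y)\<^sup>2 / (2 * v)))"
      unfolding ennreal_mult[OF gauss_nonneg gauss_nonneg, symmetric]
      by (simp add: gauss_def C_def k_def ennreal_mult'[symmetric] mult_ac)
  qed
  also have "\<dots> = ennreal C * ennreal ((2 * pi * v) powr k)"
    unfolding k_def nn_integral_gaussian_exp[OF v, symmetric] by (rule nn_integral_cmult) measurable
  also have "\<dots> = ennreal (gauss (a + b) (m - m'))"
  proof -
    have "(2 * pi * a) powr - k * (2 * pi * b) powr - k * (2 * pi * v) powr k = (2 * pi * (a + b)) powr - k"
      using a b unfolding v_def by (simp add: powr_mult powr_divide powr_minus divide_simps)
    then show ?thesis
      by (simp add: gauss_def C_def k_def ennreal_mult'[symmetric] mult_ac)
  qed
  finally show ?thesis .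
qed

text \<open>
  Expanding a normal density by \<open>c\<close> multiplies its variance by \<open>c\<^sup>2\<close>; hence \<^const>\<open>qhat\<close> replaces the
  mixing variable \<open>w\<close> by \<open>c\<^sup>2 w\<close>.
\<close>

lemma gauss_rescale:
  fixes x :: "'a::euclidean_space"
  assumes c: "0 < c" and w: "0 < w"
  shows "1 / c ^ DIM('a) * gauss w (x /\<^sub>R c) = gauss (c\<^sup>2 * w) x"
proof -
  have "(2 * pi * (c\<^sup>2 * w)) powr (- real DIM('a) / 2) = (c\<^sup>2 * (2 * pi * w)) powr (- real DIM('a) / 2)"
    by (simp add: mult_ac)
  also have "\<dots> = (c\<^sup>2) powr (- real DIM('a) / 2) * (2 * pi * w) powr (- real DIM('a) / 2)"
    using c w by (subst powr_mult) auto
  also have "(c\<^sup>2) powr (- real DIM('a) / 2) = 1 / c ^ DIM('a)"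
  proof -
    have "(c\<^sup>2) powr (- real DIM('a) / 2) = (c powr 2) powr (- real DIM('a) / 2)"
      using c by simp
    also have "\<dots> = 1 / c powr real DIM('a)"
      unfolding powr_powr by (simp add: powr_minus_divide)
    also have "\<dots> = 1 / c ^ DIM('a)"
      using c by (simp only: powr_realpow)
    finally show ?thesis .
  qed
  finally have "(2 * pi * (c\<^sup>2 * w)) powr (- real DIM('a) / 2) = 1 / c ^ DIM('a) * (2 * pi * w) powr (- real DIM('a) / 2)" .
  moreover have "(norm (x /\<^sub>R c))\<^sup>2 / (2 * w) = (norm x)\<^sup>2 / (2 * (c\<^sup>2 * w))"
    using c by (simp add: power_mult_distrib power_divide field_simps)
  ultimately show ?thesis by (simp add: gauss_def)
qed

section \<open>Scale mixtures of normals\<close>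

text \<open>
  The mixing space is an arbitrary measure space on which \<open>f\<close> gives the variance, so that a
  convolution of mixtures is again of this form, over the product space. Values are extended reals,
  so that Tonelli applies without integrability conditions.
\<close>

definition normal_mixture :: "'b measure \<Rightarrow> ('b \<Rightarrow> real) \<Rightarrow> 'a::euclidean_space \<Rightarrow> ennreal" where
  "normal_mixture A f x = (\<integral>\<^sup>+a. ennreal (gauss (f a) x) \<partial>A)"

lemma gauss_minus: "gauss v (- x) = gauss v x"
  by (simp add: gauss_def)

lemma normal_mixture_minus: "normal_mixture A f (- x) = normal_mixture A f x"
  by (simp add: normal_mixture_def gauss_minus)

lemma measurable_normal_mixture [measurable]:
  fixes g :: "'c \<Rightarrow> 'a::euclidean_space"
  assumes "sigma_finite_measure A" and [measurable]: "f \<in> borel_measurable A" "g \<in> borel_measurable M"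
  shows "(\<lambda>y. normal_mixture A f (g y)) \<in> borel_measurable M"
proof -
  interpret sigma_finite_measure A by fact
  show ?thesis unfolding normal_mixture_def by measurable
qed

lemma nn_integral_normal_mixture_mult:
  fixes m m' :: "'a::euclidean_space"
  assumes A: "sigma_finite_measure A" and B: "sigma_finite_measure B"
    and [measurable]: "f \<in> borel_measurable A" "g \<in> borel_measurable B"
    and f: "AE a in A. 0 < f a" and g: "AE b in B. 0 < g b"
  shows "(\<integral>\<^sup>+y. normal_mixture A f (y - m) * normal_mixture B g (y - m') \<partial>lborel)
    = normal_mixture (A \<Otimes>\<^sub>M B) (\<lambda>(a, b). f a + g b) (m - m')"
proof -
  interpret A: sigma_finite_measure A by fact
  interpret B: sigma_finite_measure B by fact
  interpret LA: pair_sigma_finite A "lborel :: 'a measure" ..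
  interpret LB: pair_sigma_finite B "lborel :: 'a measure" ..
  let ?f = "\<lambda>a y. ennreal (gauss (f a) (y - m))" and ?g = "\<lambda>b y. ennreal (gauss (g b) (y - m'))"
  have "(\<integral>\<^sup>+y. normal_mixture A f (y - m) * normal_mixture B g (y - m') \<partial>lborel)
    = (\<integral>\<^sup>+y. (\<integral>\<^sup>+a. (\<integral>\<^sup>+b. ?f a y * ?g b y \<partial>B) \<partial>A) \<partial>lborel)"
    unfolding normal_mixture_def
    by (simp add: nn_integral_cmult nn_integral_multc)
  also have "\<dots> = (\<integral>\<^sup>+a. (\<integral>\<^sup>+y. (\<integral>\<^sup>+b. ?f a y * ?g b y \<partial>B) \<partial>lborel) \<partial>A)"
    by (rule LA.Fubini') measurable
  also have "\<dots> = (\<integral>\<^sup>+a. (\<integral>\<^sup>+b. (\<integral>\<^sup>+y. ?f a y * ?g b y \<partial>lborel) \<partial>B) \<partial>A)"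
    by (intro nn_integral_cong LB.Fubini') measurable
  also have "\<dots> = (\<integral>\<^sup>+a. (\<integral>\<^sup>+b. ennreal (gauss (f a + g b) (m - m')) \<partial>B) \<partial>A)"
    using f
  proof (intro nn_integral_cong_AE, eventually_elim)
    case (elim a)
    show "(\<integral>\<^sup>+b. (\<integral>\<^sup>+y. ?f a y * ?g b y \<partial>lborel) \<partial>B) = (\<integral>\<^sup>+b. ennreal (gauss (f a + g b) (m - m')) \<partial>B)"
      using g
    proof (intro nn_integral_cong_AE, eventually_elim)
      case (elim b)
      show ?case by (rule nn_integral_gauss_mult_gauss) fact+
    qed
  qed
  also have "\<dots> = normal_mixture (A \<Otimes>\<^sub>M B) (\<lambda>(a, b). f a + g b) (m - m')"
    unfolding normal_mixture_def by (subst B.nn_integral_fst[symmetric]) (simp_all add: case_prod_beta)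
  finally show ?thesis .
qed

context
  fixes H :: "real measure"
  assumes H: "mixing_law H"
begin

lemma mixing_law_prob_space: "prob_space H"
  using H by (simp add: mixing_law_def real_distribution_def)

lemma mixing_law_sigma_finite: "sigma_finite_measure H"
proof -
  interpret prob_space H by (rule mixing_law_prob_space)
  show ?thesis ..
qed

lemma mixing_law_sets: "sets H = sets borel"
  using H by (simp add: mixing_law_def real_distribution_def real_distribution_axioms_def)

lemma mixing_law_pos: "AE w in H. 0 < w"
  using H by (simp add: mixing_law_def)

lemma sn_density_nonneg: "0 \<le> sn_density H x"
  by (simp add: sn_density_def)

lemma borel_measurable_sn_density [measurable]: "sn_density H \<in> borel_measurable borel"
proof -
  interpret sigma_finite_measure H by (rule mixing_law_sigma_finite)
  note mixing_law_sets [measurable_cong]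
  show ?thesis unfolding sn_density_def[abs_def] by measurable
qed

lemma ennreal_sn_density:
  fixes x :: "'a::euclidean_space"
  assumes int: "integrable H (\<lambda>w. w powr (- real DIM('a) / 2))"
  shows "ennreal (sn_density H x) = normal_mixture H (\<lambda>w. w) x"
proof -
  note mixing_law_sets [measurable_cong]
  have "integrable H (\<lambda>w. gauss w x)"
  proof (rule Bochner_Integration.integrable_bound)
    show "integrable H (\<lambda>w. (2 * pi) powr (- real DIM('a) / 2) * w powr (- real DIM('a) / 2))"
      using int by simp
    show "AE w in H. norm (gauss w x) \<le> norm ((2 * pi) powr (- real DIM('a) / 2) * w powr (- real DIM('a) / 2))"
      using mixing_law_pos
    proof eventually_elim
      case (elim w)
      have "(2 * pi * w) powr (- real DIM('a) / 2) * exp (- (norm x)\<^sup>2 / (2 * w)) \<le> (2 * pi * w) powr (- real DIM('a) / 2) * 1"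
        using elim by (intro mult_left_mono) auto
      then show ?case using elim by (simp add: gauss_def powr_mult)
    qed
  qed measurable
  then show ?thesis
    unfolding normal_mixture_def sn_density_def gauss_def
    by (subst nn_integral_eq_integral) auto
qed

lemma ennreal_qhat:
  fixes x y :: "'a::euclidean_space"
  assumes int: "integrable H (\<lambda>w. w powr (- real DIM('a) / 2))" and c: "0 < c"
  shows "ennreal (qhat (sn_density H) c y x) = normal_mixture H (\<lambda>w. c\<^sup>2 * w) (y - x)"
proof -
  note mixing_law_sets [measurable_cong]
  have "ennreal (qhat (sn_density H) c y x) = ennreal (1 / c ^ DIM('a)) * normal_mixture H (\<lambda>w. w) ((y - x) /\<^sub>R c)"
    using c by (simp add: qhat_def ennreal_mult' ennreal_sn_density[OF int, symmetric] del: times_divide_eq_left)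
  also have "\<dots> = (\<integral>\<^sup>+w. ennreal (1 / c ^ DIM('a) * gauss w ((y - x) /\<^sub>R c)) \<partial>H)"
    using c unfolding normal_mixture_def
    by (subst nn_integral_cmult[symmetric]) (simp_all add: ennreal_mult' del: times_divide_eq_left)
  also have "\<dots> = normal_mixture H (\<lambda>w. c\<^sup>2 * w) (y - x)"
    unfolding normal_mixture_def using mixing_law_pos
    by (intro nn_integral_cong_AE, eventually_elim) (simp only: gauss_rescale[OF c])
  finally show ?thesis .
qed

end

text \<open>
  The squared difference multiplied out, with the cross term moved to the left so that nothing is
  subtracted from a possibly infinite integral.
\<close>

lemma l2_loss_expand:
  fixes q f :: "'a::euclidean_space \<Rightarrow> real"
  assumes [measurable]: "q \<in> borel_measurable borel" "f \<in> borel_measurable borel"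
    and q: "\<And>x. 0 \<le> q x" and f: "\<And>x. 0 \<le> f x"
  shows "l2_loss q \<mu> f + 2 * (\<integral>\<^sup>+y. ennreal (q (y - \<mu>)) * ennreal (f y) \<partial>lborel)
    = (\<integral>\<^sup>+y. ennreal (q (y - \<mu>)) * ennreal (q (y - \<mu>)) \<partial>lborel) + (\<integral>\<^sup>+y. ennreal (f y) * ennreal (f y) \<partial>lborel)"
proof -
  have "l2_loss q \<mu> f + 2 * (\<integral>\<^sup>+y. ennreal (q (y - \<mu>)) * ennreal (f y) \<partial>lborel)
    = (\<integral>\<^sup>+y. ennreal ((q (y - \<mu>) - f y)\<^sup>2) + 2 * (ennreal (q (y - \<mu>)) * ennreal (f y)) \<partial>lborel)"
    unfolding l2_loss_def by (simp add: nn_integral_add nn_integral_cmult)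
  also have "\<dots> = (\<integral>\<^sup>+y. ennreal (q (y - \<mu>)) * ennreal (q (y - \<mu>)) + ennreal (f y) * ennreal (f y) \<partial>lborel)"
  proof (intro nn_integral_cong)
    fix y
    have "(q (y - \<mu>) - f y)\<^sup>2 + 2 * (q (y - \<mu>) * f y) = q (y - \<mu>) * q (y - \<mu>) + f y * f y"
      by (simp add: power2_eq_square algebra_simps)
    then show "ennreal ((q (y - \<mu>) - f y)\<^sup>2) + 2 * (ennreal (q (y - \<mu>)) * ennreal (f y))
      = ennreal (q (y - \<mu>)) * ennreal (q (y - \<mu>)) + ennreal (f y) * ennreal (f y)"
      using q f by (simp add: ennreal_mult[symmetric] ennreal_plus[symmetric] ennreal_numeral[symmetric] del: ennreal_plus ennreal_numeral)
  qed
  also have "\<dots> = (\<integral>\<^sup>+y. ennreal (q (y - \<mu>)) * ennreal (q (y - \<mu>)) \<partial>lborel) + (\<integral>\<^sup>+y. ennreal (f y) * ennreal (f y) \<partial>lborel)"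
    by (rule nn_integral_add) auto
  finally show ?thesis .
qed

section \<open>The risk as an integral over the mixing variables\<close>

text \<open>
  Each of the three integrals in the expanded risk is a convolution of normal mixtures evaluated
  at a difference of locations. For the two squares this difference is \<open>0\<close> already; in the cross term
  it is \<open>X - \<mu>\<close>, and averaging over the law of \<open>X\<close> is one more convolution, again evaluated at \<open>0\<close>.
  The location parameter has then disappeared.
\<close>

lemma l2_risk_qhat:
  fixes G H :: "real measure"
    and P :: "'a::euclidean_space \<Rightarrow> 's measure" and X :: "'s \<Rightarrow> 'a"
  assumes G: "mixing_law G" "integrable G (\<lambda>v. v powr (- real DIM('a) / 2))"
    and H: "mixing_law H" "integrable H (\<lambda>w. w powr (- real DIM('a) / 2))"
    and P: "prob_space (P \<mu>)"
    and X: "distributed (P \<mu>) lborel (\<lambda>s. X s - \<mu>) (\<lambda>x. ennreal (sn_density G x))"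
    and c: "0 < c"
  shows "l2_risk P X (sn_density H) \<mu> (qhat (sn_density H) c)
      + 2 * normal_mixture (G \<Otimes>\<^sub>M (H \<Otimes>\<^sub>M H)) (\<lambda>(v, w). v + (case w of (w, w') \<Rightarrow> w + c\<^sup>2 * w')) (0::'a)
    = normal_mixture (H \<Otimes>\<^sub>M H) (\<lambda>(w, w'). w + w') (0::'a)
      + normal_mixture (H \<Otimes>\<^sub>M H) (\<lambda>(w, w'). c\<^sup>2 * w + c\<^sup>2 * w') (0::'a)"
proof -
  interpret P: prob_space "P \<mu>" by fact
  note [measurable_cong] = mixing_law_sets[OF G(1)] mixing_law_sets[OF H(1)]
  note [measurable] = borel_measurable_sn_density[OF H(1)] borel_measurable_sn_density[OF G(1)]
  note sigma_fin = mixing_law_sigma_finite[OF G(1)] mixing_law_sigma_finite[OF H(1)]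
  interpret H: sigma_finite_measure H by fact
  interpret HH: pair_sigma_finite H H ..
  have sigma_HH: "sigma_finite_measure (H \<Otimes>\<^sub>M H)" by (rule HH.sigma_finite_measure_axioms)
  have pos: "AE w in H. 0 < w" by (rule mixing_law_pos[OF H(1)])
  have cpos: "AE w in H. 0 < c\<^sup>2 * w" using pos by eventually_elim (use c in simp)
  define q where "q = (sn_density H :: 'a \<Rightarrow> real)"
  have qmeas [measurable]: "q \<in> borel_measurable borel" by (simp add: q_def)
  have qc_meas [measurable]: "(\<lambda>(y, x). qhat q c y x) \<in> borel_measurable (borel \<Otimes>\<^sub>M borel)"
    unfolding qhat_def by measurable
  have qc_meas' [measurable]: "(\<lambda>y. qhat q c y x) \<in> borel_measurable borel" for x
    unfolding qhat_def by measurable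
  have q_nonneg: "0 \<le> q x" for x by (simp add: q_def sn_density_nonneg[OF H(1)])
  have qc_nonneg: "0 \<le> qhat q c y x" for y x using c q_nonneg by (simp add: qhat_def)
  have q_mix: "ennreal (q y) = normal_mixture H (\<lambda>w. w) y" for y
    unfolding q_def by (rule ennreal_sn_density[OF H])
  have qc_mix: "ennreal (qhat q c y x) = normal_mixture H (\<lambda>w. c\<^sup>2 * w) (y - x)" for y x
    unfolding q_def by (rule ennreal_qhat[OF H c])
  let ?K = "normal_mixture (H \<Otimes>\<^sub>M H) (\<lambda>(w, w'). w + c\<^sup>2 * w') :: 'a \<Rightarrow> ennreal"
  let ?S = "normal_mixture (H \<Otimes>\<^sub>M H) (\<lambda>(w, w'). w + w') (0::'a)
      + normal_mixture (H \<Otimes>\<^sub>M H) (\<lambda>(w, w'). c\<^sup>2 * w + c\<^sup>2 * w') (0::'a)"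
  have K_meas [measurable]: "?K \<in> borel_measurable borel"
    by (rule measurable_normal_mixture[OF sigma_HH]) auto
  have loss: "l2_loss q \<mu> (\<lambda>y. qhat q c y x) + 2 * ?K (x - \<mu>) = ?S" for x
  proof -
    have "?K (x - \<mu>) = ?K (\<mu> - x)"
      using normal_mixture_minus[of _ _ "\<mu> - x"] by simp
    also have "\<dots> = (\<integral>\<^sup>+y. ennreal (q (y - \<mu>)) * ennreal (qhat q c y x) \<partial>lborel)"
      unfolding q_mix qc_mix
      by (rule nn_integral_normal_mixture_mult[symmetric]) (use sigma_fin pos cpos in auto)
    finally have "l2_loss q \<mu> (\<lambda>y. qhat q c y x) + 2 * ?K (x - \<mu>)
      = (\<integral>\<^sup>+y. ennreal (q (y - \<mu>)) * ennreal (q (y - \<mu>)) \<partial>lborel)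
        + (\<integral>\<^sup>+y. ennreal (qhat q c y x) * ennreal (qhat q c y x) \<partial>lborel)"
      by (simp add: l2_loss_expand[OF qmeas qc_meas' q_nonneg qc_nonneg])
    also have "(\<integral>\<^sup>+y. ennreal (q (y - \<mu>)) * ennreal (q (y - \<mu>)) \<partial>lborel)
      = normal_mixture (H \<Otimes>\<^sub>M H) (\<lambda>(w, w'). w + w') (\<mu> - \<mu>)"
      unfolding q_mix
      by (rule nn_integral_normal_mixture_mult) (use sigma_fin pos in auto)
    also have "(\<integral>\<^sup>+y. ennreal (qhat q c y x) * ennreal (qhat q c y x) \<partial>lborel)
      = normal_mixture (H \<Otimes>\<^sub>M H) (\<lambda>(w, w'). c\<^sup>2 * w + c\<^sup>2 * w') (x - x)"
      unfolding qc_mix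
      by (rule nn_integral_normal_mixture_mult) (use sigma_fin cpos in auto)
    finally show ?thesis by simp
  qed
  have X_meas [measurable]: "X \<in> borel_measurable (P \<mu>)"
  proof -
    have "(\<lambda>s. X s - \<mu>) \<in> borel_measurable (P \<mu>)"
      using distributed_measurable[OF X] by simp
    then have "(\<lambda>s. (X s - \<mu>) + \<mu>) \<in> borel_measurable (P \<mu>)" by (intro borel_measurable_add) auto
    then show ?thesis by simp
  qed
  have cross: "(\<integral>\<^sup>+s. ?K (X s - \<mu>) \<partial>P \<mu>)
    = normal_mixture (G \<Otimes>\<^sub>M (H \<Otimes>\<^sub>M H)) (\<lambda>(v, w). v + (case w of (w, w') \<Rightarrow> w + c\<^sup>2 * w')) (0::'a)"
  proof -
    have posHH: "AE w in H \<Otimes>\<^sub>M H. 0 < (case w of (w, w') \<Rightarrow> w + c\<^sup>2 * w')"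
    proof (rule HH.AE_pair_measure)
      show "AE x in H. AE y in H. 0 < (case (x, y) of (w, w') \<Rightarrow> w + c\<^sup>2 * w')"
        using pos
      proof eventually_elim
        case (elim x)
        show ?case using cpos by eventually_elim (use elim in auto)
      qed
    qed measurable
    have "(\<integral>\<^sup>+s. ?K (X s - \<mu>) \<partial>P \<mu>) = (\<integral>\<^sup>+x. ennreal (sn_density G x) * ?K x \<partial>lborel)"
      by (rule distributed_nn_integral[OF X, symmetric]) measurable
    also have "\<dots> = (\<integral>\<^sup>+x. normal_mixture G (\<lambda>v. v) (x - 0) * ?K (x - 0) \<partial>lborel)"
      by (simp add: ennreal_sn_density[OF G])
    also have "\<dots> = normal_mixture (G \<Otimes>\<^sub>M (H \<Otimes>\<^sub>M H)) (\<lambda>(v, w). v + (case w of (w, w') \<Rightarrow> w + c\<^sup>2 * w')) ((0::'a) - 0)"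
      by (rule nn_integral_normal_mixture_mult[where f = "\<lambda>v. v" and g = "\<lambda>(w, w'). w + c\<^sup>2 * w'"])
        (use sigma_fin sigma_HH posHH mixing_law_pos[OF G(1)] in auto)
    finally show ?thesis by simp
  qed
  have loss_meas [measurable]: "(\<lambda>s. l2_loss q \<mu> (\<lambda>y. qhat q c y (X s))) \<in> borel_measurable (P \<mu>)"
    unfolding l2_loss_def qhat_def by measurable
  have "l2_risk P X q \<mu> (qhat q c) + 2 * (\<integral>\<^sup>+s. ?K (X s - \<mu>) \<partial>P \<mu>)
    = (\<integral>\<^sup>+s. l2_loss q \<mu> (\<lambda>y. qhat q c y (X s)) + 2 * ?K (X s - \<mu>) \<partial>P \<mu>)"
    unfolding l2_risk_def by (subst nn_integral_add) (auto simp: nn_integral_cmult)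
  also have "\<dots> = ?S"
    unfolding loss by (simp add: P.emeasure_space_1)
  finally show ?thesis unfolding cross q_def .
qed

section \<open>Convexity\<close>

text \<open>
  For \<open>d = 2 k\<close> and \<open>t = c\<^sup>-\<^sup>d\<close> one has \<open>(A + c\<^sup>2 W)\<^sup>-\<^sup>k = t (A t\<^sup>1\<^sup>/\<^sup>k + W)\<^sup>-\<^sup>k\<close>. The right-hand side
  makes sense down to \<open>t = 0\<close>, that is \<open>c = \<infinity>\<close>, and its derivative \<open>W (A t\<^sup>1\<^sup>/\<^sup>k + W)\<^sup>-\<^sup>k\<^sup>-\<^sup>1\<close> decreases in
  \<open>t\<close>: it is concave. Both functions are at most \<open>W\<^sup>-\<^sup>k\<close> on the unit interval, which will be the
  integrable majorant.
\<close>

lemma perspective_bounds: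
  fixes A W k t :: real
  assumes "0 < A" "0 < W" "0 < k" "0 \<le> t" "t \<le> 1"
  shows "t * (A * t powr (1 / k) + W) powr (- k) \<le> W powr (- k)"
    and "W * (A * t powr (1 / k) + W) powr (- k - 1) \<le> W powr (- k)"
proof -
  have le: "W \<le> A * t powr (1 / k) + W" using assms by simp
  have a: "(A * t powr (1 / k) + W) powr (- k) \<le> W powr (- k)"
    using le assms by (intro powr_mono2') auto
  show "t * (A * t powr (1 / k) + W) powr (- k) \<le> W powr (- k)"
    using mult_mono[OF \<open>t \<le> 1\<close> a] assms by simp
  have "(A * t powr (1 / k) + W) powr (- k - 1) \<le> W powr (- k - 1)"
    using le assms by (intro powr_mono2') auto
  then have "W * (A * t powr (1 / k) + W) powr (- k - 1) \<le> W * W powr (- k - 1)"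
    using assms by (intro mult_left_mono) auto
  also have "\<dots> = W powr (- k)"
    using assms by (simp add: powr_diff)
  finally show "W * (A * t powr (1 / k) + W) powr (- k - 1) \<le> W powr (- k)" .
qed

lemma perspective_deriv_strict_decreasing:
  fixes A W k s t :: real
  assumes "0 < A" "0 < W" "0 < k" "0 \<le> s" "s < t"
  shows "W * (A * t powr (1 / k) + W) powr (- k - 1) < W * (A * s powr (1 / k) + W) powr (- k - 1)"
proof -
  have "s powr (1 / k) < t powr (1 / k)"
    using assms by (intro powr_less_mono2) auto
  then have "A * s powr (1 / k) + W < A * t powr (1 / k) + W" using assms by simp
  moreover have "0 < A * s powr (1 / k) + W" using assms by (simp add: add_nonneg_pos)
  ultimately show ?thesis
    using assms by (intro mult_strict_left_mono powr_less_mono2_neg) auto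
qed

lemma perspective_has_derivative:
  fixes A W k t :: real
  assumes "0 < A" "0 < W" "0 < k" "0 < t"
  shows "((\<lambda>t. t * (A * t powr (1 / k) + W) powr (- k)) has_real_derivative
     W * (A * t powr (1 / k) + W) powr (- k - 1)) (at t)"
proof -
  define B where "B = A * t powr (1 / k) + W"
  have B: "0 < B" using assms by (simp add: B_def add_nonneg_pos)
  have "((\<lambda>t. t * (A * t powr (1 / k) + W) powr (- k)) has_real_derivative
     B powr (- k) + t * (- k * B powr (- k - 1) * (A * (1 / k * t powr (1 / k - 1))))) (at t)"
    using assms B unfolding B_def by (auto intro!: derivative_eq_intros)
  moreover have "B powr (- k) + t * (- k * B powr (- k - 1) * (A * (1 / k * t powr (1 / k - 1))))
    = W * B powr (- k - 1)"
  proof -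
    have 1: "B powr (- k) = B * B powr (- k - 1)" using B by (simp add: powr_diff)
    have 2: "t powr (1 / k) = t * t powr (1 / k - 1)" using assms by (simp add: powr_diff)
    have "t * (- k * B powr (- k - 1) * (A * (1 / k * t powr (1 / k - 1)))) = - (A * t powr (1 / k)) * B powr (- k - 1)"
      unfolding 2 using assms by simp
    then show ?thesis unfolding 1 by (simp add: B_def algebra_simps)
  qed
  ultimately show ?thesis by (simp add: B_def)
qed

text \<open>
  Concavity in the form of the tangent inequality, which survives taking expectations and so
  replaces differentiation under the integral. The endpoint \<open>0\<close>, where the derivative formula is not
  available, is reached by the mean value theorem.
\<close>

lemma perspective_slope:
  fixes A W k s t :: real
  assumes AWk: "0 < A" "0 < W" "0 < k" and st: "0 \<le> s" "0 \<le> t"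
  shows "s * (A * s powr (1 / k) + W) powr (- k) - t * (A * t powr (1 / k) + W) powr (- k)
    \<le> W * (A * t powr (1 / k) + W) powr (- k - 1) * (s - t)"
proof -
  define \<phi> where "\<phi> t = t * (A * t powr (1 / k) + W) powr (- k)" for t
  define \<phi>' where "\<phi>' t = W * (A * t powr (1 / k) + W) powr (- k - 1)" for t
  have mvt: "\<exists>z>x. z < y \<and> \<phi> y - \<phi> x = (y - x) * \<phi>' z" if "0 \<le> x" "x < y" for x y
  proof -
    have pos: "0 < A * t powr (1 / k) + W" for t using AWk by (simp add: add_nonneg_pos)
    have "continuous_on {x..y} \<phi>"
      unfolding \<phi>_def using pos AWk that
      by (intro continuous_intros continuous_on_powr') (auto simp: less_imp_neq[OF pos, symmetric])
    moreover have "\<phi> differentiable (at w)" if "x < w" for w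
      using perspective_has_derivative[OF AWk, of w] that \<open>0 \<le> x\<close>
      unfolding \<phi>_def[abs_def] real_differentiable_def by auto
    ultimately have "\<exists>l z. x < z \<and> z < y \<and> (\<phi> has_real_derivative l) (at z) \<and> \<phi> y - \<phi> x = (y - x) * l"
      using \<open>x < y\<close> by (intro MVT) auto
    then obtain l z where z: "x < z" "z < y" "(\<phi> has_real_derivative l) (at z)" "\<phi> y - \<phi> x = (y - x) * l"
      by blast
    have "(\<phi> has_real_derivative \<phi>' z) (at z)"
      unfolding \<phi>_def[abs_def] \<phi>'_def using z(1) that AWk by (intro perspective_has_derivative) auto
    then show ?thesis using z DERIV_unique by blast
  qed
  have dec: "\<phi>' y < \<phi>' x" if "0 \<le> x" "x < y" for x y
    unfolding \<phi>'_def using perspective_deriv_strict_decreasing[OF AWk that] .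
  have "\<phi> s - \<phi> t \<le> \<phi>' t * (s - t)"
  proof (cases s t rule: linorder_cases)
    case less
    obtain z where z: "s < z" "z < t" "\<phi> t - \<phi> s = (t - s) * \<phi>' z" using mvt[OF st(1) less] by blast
    have "(t - s) * \<phi>' t \<le> (t - s) * \<phi>' z" using dec[of z t] z st by (intro mult_left_mono) auto
    then show ?thesis using z(3) by (simp add: algebra_simps)
  next
    case greater
    obtain z where z: "t < z" "z < s" "\<phi> s - \<phi> t = (s - t) * \<phi>' z" using mvt[OF st(2) greater] by blast
    have "(s - t) * \<phi>' z \<le> (s - t) * \<phi>' t" using dec[of t z] z st by (intro mult_left_mono) auto
    then show ?thesis using z(3) by (simp add: algebra_simps)
  qed simp
  then show ?thesis by (simp add: \<phi>_def \<phi>'_def)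
qed

text \<open>
  All that is needed about the risk as a function of \<open>t\<close>. The first two assumptions say that \<open>F\<close> is
  strictly convex with subgradient \<open>E\<close>; the sign change of \<open>E\<close> puts the minimum in the interior.
  A strictly convex function lies below the larger of its end values, and, if it starts above \<open>F 1\<close>,
  it crosses the level \<open>F 1\<close> exactly once before \<open>1\<close>.
\<close>

lemma strictly_convex_unit_interval:
  fixes F E :: "real \<Rightarrow> real"
  assumes slope: "\<And>s t. s \<in> {0..1} \<Longrightarrow> t \<in> {0..1} \<Longrightarrow> E t * (s - t) \<le> F s - F t"
    and mono: "\<And>s t. s \<in> {0..1} \<Longrightarrow> t \<in> {0..1} \<Longrightarrow> s < t \<Longrightarrow> E s < E t"
    and cont: "continuous_on {0..1} E"
    and ends: "E 0 < 0" "0 < E 1"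
  obtains z where "0 < z" "z < 1" "E z = 0"
    and "\<And>t. t \<in> {0..1} \<Longrightarrow> E t = 0 \<Longrightarrow> t = z"
    and "\<And>t. t \<in> {0..1} \<Longrightarrow> t \<noteq> z \<Longrightarrow> F z < F t"
    and "\<And>t. F 0 \<le> F 1 \<Longrightarrow> 0 < t \<Longrightarrow> t < 1 \<Longrightarrow> F t < F 1"
    and "F 1 < F 0 \<Longrightarrow> \<exists>r. 0 < r \<and> r < 1 \<and> F r = F 1 \<and> (\<forall>t. 0 < t \<longrightarrow> t < 1 \<longrightarrow> F t = F 1 \<longrightarrow> t = r)
       \<and> (\<forall>t. r < t \<longrightarrow> t < 1 \<longrightarrow> F t < F 1)"
proof -
  have convex: "F t < max (F x) (F y)" if "0 \<le> x" "x < t" "t < y" "y \<le> 1" for x t y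
  proof (cases "E t" "0::real" rule: linorder_cases)
    case less
    then have "0 < E t * (x - t)" using that by (simp add: mult_neg_neg)
    then show ?thesis using slope[of x t] that by auto
  next
    case greater
    then have "0 < E t * (y - t)" using that by simp
    then show ?thesis using slope[of y t] that by auto
  next
    case equal
    \<comment> \<open>The tangent at \<open>t\<close> is horizontal and gives no strict inequality; a tangent further right does.\<close>
    let ?m = "(t + y) / 2"
    have "0 < E ?m" using mono[of t ?m] equal that by auto
    then have "0 < E ?m * (y - ?m)" using that by simp
    then have "F ?m < F y" using slope[of y ?m] that by auto
    moreover have "F t \<le> F ?m" using slope[of ?m t] equal that by auto
    ultimately show ?thesis by auto
  qed
  obtain z where z: "0 \<le> z" "z \<le> 1" "E z = 0"
    using IVT'[of E 0 0 1] ends cont by auto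
  have z': "0 < z" "z < 1" using z ends by (auto simp: order_less_le)
  have min: "F z < F t" if "t \<in> {0..1}" "t \<noteq> z" for t
  proof -
    have ge: "F z \<le> F s" if "s \<in> {0..1}" for s using slope[of s z] z that by auto
    let ?m = "(t + z) / 2"
    have "F ?m < max (F t) (F z)"
      using convex[of t ?m z] convex[of z ?m t] that z by (cases t z rule: linorder_cases) (auto simp: max.commute)
    moreover have "F z \<le> F ?m" using ge[of ?m] that z by auto
    ultimately show ?thesis by auto
  qed
  have contF: "continuous_on {0..1} F"
  proof -
    \<comment> \<open>The monotone \<open>E\<close> is bounded by its end values, so the two tangent inequalities make \<open>F\<close> Lipschitz.\<close>
    define B where "B = max \<bar>E 0\<bar> \<bar>E 1\<bar>"
    have E_le: "\<bar>E t\<bar> \<le> B" if "t \<in> {0..1}" for t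
      using mono[of 0 t] mono[of t 1] that unfolding B_def by (cases "t = 0"; cases "t = 1"; force)
    have lip: "\<bar>F s - F t\<bar> \<le> B * \<bar>s - t\<bar>" if "s \<in> {0..1}" "t \<in> {0..1}" for s t
    proof -
      have "\<bar>E t * (s - t)\<bar> \<le> B * \<bar>s - t\<bar>" "\<bar>E s * (t - s)\<bar> \<le> B * \<bar>s - t\<bar>"
        using E_le that by (auto simp: abs_mult abs_minus_commute intro!: mult_right_mono)
      then show ?thesis using slope[OF that] slope[OF that(2,1)] by linarith
    qed
    have "B-lipschitz_on {0..1} F"
      by (rule lipschitz_onI) (use lip in \<open>auto simp: dist_real_def B_def[symmetric]\<close>, simp add: B_def)
    then show ?thesis by (rule lipschitz_on_continuous_on)
  qed
  show thesis
  proof (rule that[OF z' z(3) _ min])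
    show "t = z" if "t \<in> {0..1}" "E t = 0" for t
      using mono[of t z] mono[of z t] that z by (cases t z rule: linorder_cases) auto
    show "F t < F 1" if "F 0 \<le> F 1" "0 < t" "t < 1" for t
      using convex[of 0 t 1] that by auto
    assume less: "F 1 < F 0"
    \<comment> \<open>\<open>F\<close> falls from above \<open>F 1\<close> at \<open>0\<close> to below it at the minimum \<open>z\<close>.\<close>
    have "continuous_on {0..z} F" using contF z by (auto elim: continuous_on_subset)
    then obtain r where r: "0 \<le> r" "r \<le> z" "F r = F 1"
      using IVT2'[of F z "F 1" 0] min[of 1] z' less by auto
    have r': "0 < r" "r < 1" using r less z' by (auto simp: order_less_le)
    have right: "F t < F 1" if "r < t" "t < 1" for t
      using convex[of r t 1] that r r' by auto
    have "F t \<noteq> F 1" if "0 < t" "t < r" for t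
      using convex[of t r 1] that r r' by auto
    then show "\<exists>r. 0 < r \<and> r < 1 \<and> F r = F 1 \<and> (\<forall>t. 0 < t \<longrightarrow> t < 1 \<longrightarrow> F t = F 1 \<longrightarrow> t = r)
       \<and> (\<forall>t. r < t \<longrightarrow> t < 1 \<longrightarrow> F t < F 1)"
      using r r' right by (intro exI[of _ r]) (metis less_irrefl linorder_neqE)
  qed
qed

section \<open>Moments of the mixing variables\<close>

text \<open>
  Here \<open>k\<close> stands for half the dimension. Leaving it an arbitrary positive real separates the
  moments from the space on which the densities live.
\<close>

locale mixing_variables = prob_space \<Omega> for \<Omega> :: "'w measure" +
  fixes V W\<^sub>1 W\<^sub>2 :: "'w \<Rightarrow> real" and G H :: "real measure" and k :: real
  assumes indep: "indep_vars (\<lambda>_. borel) (\<lambda>i. [V, W\<^sub>1, W\<^sub>2] ! i) {..<3}"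
    and distr: "distr \<Omega> borel V = G" "distr \<Omega> borel W\<^sub>1 = H" "distr \<Omega> borel W\<^sub>2 = H"
    and pos: "AE v in G. 0 < v" "AE w in H. 0 < w"
    and k: "0 < k"
    and int_H: "integrable H (\<lambda>w. w powr - k)"
begin

lemma rv [measurable]:
  "V \<in> borel_measurable \<Omega>" "W\<^sub>1 \<in> borel_measurable \<Omega>" "W\<^sub>2 \<in> borel_measurable \<Omega>"
proof -
  have "(\<lambda>i. [V, W\<^sub>1, W\<^sub>2] ! i) i \<in> borel_measurable \<Omega>" if "i \<in> {..<3}" for i
    using indep that unfolding indep_vars_def by blast
  from this[of 0] this[of 1] this[of 2]
  show "V \<in> borel_measurable \<Omega>" "W\<^sub>1 \<in> borel_measurable \<Omega>" "W\<^sub>2 \<in> borel_measurable \<Omega>" by auto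
qed

lemma distr_W: "distr \<Omega> (borel \<Otimes>\<^sub>M borel) (\<lambda>\<omega>. (W\<^sub>1 \<omega>, W\<^sub>2 \<omega>)) = H \<Otimes>\<^sub>M H"
proof -
  have "indep_var borel ((\<lambda>f. f 1) \<circ> (\<lambda>\<omega>. restrict (\<lambda>i. ([V, W\<^sub>1, W\<^sub>2] ! i) \<omega>) {1}))
     borel ((\<lambda>f. f 2) \<circ> (\<lambda>\<omega>. restrict (\<lambda>i. ([V, W\<^sub>1, W\<^sub>2] ! i) \<omega>) {2::nat}))"
    by (intro indep_var_compose[OF indep_var_restrict[OF indep]]) auto
  then have "indep_var borel W\<^sub>1 borel W\<^sub>2" by (simp add: comp_def)
  then show ?thesis unfolding indep_var_distribution_eq distr by simp
qed

lemma distr_VW: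
  "distr \<Omega> (borel \<Otimes>\<^sub>M (borel \<Otimes>\<^sub>M borel)) (\<lambda>\<omega>. (V \<omega>, (W\<^sub>1 \<omega>, W\<^sub>2 \<omega>))) = G \<Otimes>\<^sub>M (H \<Otimes>\<^sub>M H)"
proof -
  \<comment> \<open>The predicate \<open>indep_var\<close> relates variables with values in one type, so \<open>V\<close> is compared with the pair
      \<open>(W\<^sub>1, W\<^sub>2)\<close> through restrictions of the whole family, which are all functions on indices.\<close>
  let ?J = "\<lambda>A \<omega>. restrict (\<lambda>i. ([V, W\<^sub>1, W\<^sub>2] ! i) \<omega>) A"
  let ?P = "\<lambda>A. \<Pi>\<^sub>M i\<in>A. borel :: real measure"
  have ind: "indep_var (?P {0}) (?J {0}) (?P {1, 2}) (?J {1, 2})"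
    by (rule indep_var_restrict[OF indep]) auto
  note [measurable] = indep_var_rv1[OF ind] indep_var_rv2[OF ind]
  have V: "G = distr (distr \<Omega> (?P {0}) (?J {0})) borel (\<lambda>f. f 0)"
    by (subst distr_distr) (simp_all add: comp_def distr)
  have W: "H \<Otimes>\<^sub>M H = distr (distr \<Omega> (?P {1, 2}) (?J {1, 2})) (borel \<Otimes>\<^sub>M borel) (\<lambda>f. (f 1, f 2))"
    by (subst distr_distr) (simp_all add: comp_def distr_W del: One_nat_def)
  have "prob_space (distr (distr \<Omega> (?P {1, 2}) (?J {1, 2})) (borel \<Otimes>\<^sub>M borel) (\<lambda>f. (f 1, f 2)))"
    by (intro prob_space.prob_space_distr prob_space_distr) measurable
  then have "sigma_finite_measure (distr (distr \<Omega> (?P {1, 2}) (?J {1, 2})) (borel \<Otimes>\<^sub>M borel) (\<lambda>f. (f 1, f 2)))"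
    by (rule prob_space_imp_sigma_finite)
  then have "G \<Otimes>\<^sub>M (H \<Otimes>\<^sub>M H)
    = distr (distr \<Omega> (?P {0}) (?J {0}) \<Otimes>\<^sub>M distr \<Omega> (?P {1, 2}) (?J {1, 2}))
        (borel \<Otimes>\<^sub>M (borel \<Otimes>\<^sub>M borel)) (\<lambda>(f, g). (f 0, (g 1, g 2)))"
    unfolding V W by (subst pair_measure_distr) (simp_all del: One_nat_def)
  also have "distr \<Omega> (?P {0}) (?J {0}) \<Otimes>\<^sub>M distr \<Omega> (?P {1, 2}) (?J {1, 2})
    = distr \<Omega> (?P {0} \<Otimes>\<^sub>M ?P {1, 2}) (\<lambda>\<omega>. (?J {0} \<omega>, ?J {1, 2} \<omega>))"
    using ind unfolding indep_var_distribution_eq by blast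
  also have "distr \<dots> (borel \<Otimes>\<^sub>M (borel \<Otimes>\<^sub>M borel)) (\<lambda>(f, g). (f 0, (g 1, g 2)))
    = distr \<Omega> (borel \<Otimes>\<^sub>M (borel \<Otimes>\<^sub>M borel)) (\<lambda>\<omega>. (V \<omega>, (W\<^sub>1 \<omega>, W\<^sub>2 \<omega>)))"
    by (subst distr_distr) (simp_all add: comp_def del: One_nat_def)
  finally show ?thesis by simp
qed

lemma AE_pos: "AE \<omega> in \<Omega>. 0 < V \<omega> \<and> 0 < W\<^sub>1 \<omega> \<and> 0 < W\<^sub>2 \<omega>"
proof -
  have "AE \<omega> in \<Omega>. 0 < V \<omega>"
    using pos(1) unfolding distr(1)[symmetric] by (rule AE_distrD[rotated]) measurable
  moreover have "AE \<omega> in \<Omega>. 0 < W\<^sub>1 \<omega>"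
    using pos(2) unfolding distr(2)[symmetric] by (rule AE_distrD[rotated]) measurable
  moreover have "AE \<omega> in \<Omega>. 0 < W\<^sub>2 \<omega>"
    using pos(2) unfolding distr(3)[symmetric] by (rule AE_distrD[rotated]) measurable
  ultimately show ?thesis by eventually_elim simp
qed

lemma integrable_W2: "integrable \<Omega> (\<lambda>\<omega>. W\<^sub>2 \<omega> powr - k)"
  using int_H unfolding distr(3)[symmetric] by (subst (asm) integrable_distr_eq) measurable

lemma integrable_W: "integrable \<Omega> (\<lambda>\<omega>. (W\<^sub>1 \<omega> + W\<^sub>2 \<omega>) powr - k)"
proof (rule Bochner_Integration.integrable_bound[OF integrable_W2])
  show "AE \<omega> in \<Omega>. norm ((W\<^sub>1 \<omega> + W\<^sub>2 \<omega>) powr - k) \<le> norm (W\<^sub>2 \<omega> powr - k)"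
    using AE_pos by eventually_elim (use k in \<open>auto intro!: powr_mono2'\<close>)
qed measurable

text \<open>
  In the variable \<open>t = c\<^sup>-\<^sup>d\<close>, \<open>\<Phi> t\<close> is the moment \<open>M\<^sub>c\<close> of the theorem and \<open>\<Phi>' t\<close> its derivative.
\<close>

definition \<Phi> :: "real \<Rightarrow> real" where
  "\<Phi> t = expectation (\<lambda>\<omega>. t * ((V \<omega> + W\<^sub>1 \<omega>) * t powr (1 / k) + W\<^sub>2 \<omega>) powr - k)"

definition \<Phi>' :: "real \<Rightarrow> real" where
  "\<Phi>' t = expectation (\<lambda>\<omega>. W\<^sub>2 \<omega> * ((V \<omega> + W\<^sub>1 \<omega>) * t powr (1 / k) + W\<^sub>2 \<omega>) powr (- k - 1))"

definition N :: real where
  "N = expectation (\<lambda>\<omega>. (W\<^sub>1 \<omega> + W\<^sub>2 \<omega>) powr - k)"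

lemma integrable_\<Phi>:
  assumes t: "t \<in> {0..1}"
  shows "integrable \<Omega> (\<lambda>\<omega>. t * ((V \<omega> + W\<^sub>1 \<omega>) * t powr (1 / k) + W\<^sub>2 \<omega>) powr - k)"
proof (rule Bochner_Integration.integrable_bound[OF integrable_W2])
  show "AE \<omega> in \<Omega>. norm (t * ((V \<omega> + W\<^sub>1 \<omega>) * t powr (1 / k) + W\<^sub>2 \<omega>) powr - k) \<le> norm (W\<^sub>2 \<omega> powr - k)"
    using AE_pos
  proof eventually_elim
    case (elim \<omega>)
    then show ?case using perspective_bounds(1)[of "V \<omega> + W\<^sub>1 \<omega>" "W\<^sub>2 \<omega>" k t] k t by simp
  qed
qed measurable

lemma AE_\<Phi>'_bound:
  assumes t: "t \<in> {0..1}"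
  shows "AE \<omega> in \<Omega>. norm (W\<^sub>2 \<omega> * ((V \<omega> + W\<^sub>1 \<omega>) * t powr (1 / k) + W\<^sub>2 \<omega>) powr (- k - 1)) \<le> W\<^sub>2 \<omega> powr - k"
  using AE_pos
proof eventually_elim
  case (elim \<omega>)
  then show ?case using perspective_bounds(2)[of "V \<omega> + W\<^sub>1 \<omega>" "W\<^sub>2 \<omega>" k t] k t by simp
qed

lemma integrable_\<Phi>':
  assumes t: "t \<in> {0..1}"
  shows "integrable \<Omega> (\<lambda>\<omega>. W\<^sub>2 \<omega> * ((V \<omega> + W\<^sub>1 \<omega>) * t powr (1 / k) + W\<^sub>2 \<omega>) powr (- k - 1))"
  by (rule Bochner_Integration.integrable_bound[OF integrable_W2]) (use AE_\<Phi>'_bound[OF t] in auto)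

lemma \<Phi>_slope:
  assumes s: "s \<in> {0..1}" and t: "t \<in> {0..1}"
  shows "\<Phi> s - \<Phi> t \<le> \<Phi>' t * (s - t)"
proof -
  have "\<Phi> s - \<Phi> t = expectation (\<lambda>\<omega>. s * ((V \<omega> + W\<^sub>1 \<omega>) * s powr (1 / k) + W\<^sub>2 \<omega>) powr - k
      - t * ((V \<omega> + W\<^sub>1 \<omega>) * t powr (1 / k) + W\<^sub>2 \<omega>) powr - k)"
    unfolding \<Phi>_def using integrable_\<Phi>[OF s] integrable_\<Phi>[OF t] by simp
  also have "\<dots> \<le> expectation (\<lambda>\<omega>. W\<^sub>2 \<omega> * ((V \<omega> + W\<^sub>1 \<omega>) * t powr (1 / k) + W\<^sub>2 \<omega>) powr (- k - 1) * (s - t))"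
  proof (rule integral_mono_AE)
    show "AE \<omega> in \<Omega>. s * ((V \<omega> + W\<^sub>1 \<omega>) * s powr (1 / k) + W\<^sub>2 \<omega>) powr - k
      - t * ((V \<omega> + W\<^sub>1 \<omega>) * t powr (1 / k) + W\<^sub>2 \<omega>) powr - k
      \<le> W\<^sub>2 \<omega> * ((V \<omega> + W\<^sub>1 \<omega>) * t powr (1 / k) + W\<^sub>2 \<omega>) powr (- k - 1) * (s - t)"
      using AE_pos by eventually_elim (rule perspective_slope, use k s t in auto)
  qed (use integrable_\<Phi>[OF s] integrable_\<Phi>[OF t] integrable_\<Phi>'[OF t] in auto)
  also have "\<dots> = \<Phi>' t * (s - t)" by (simp add: \<Phi>'_def)
  finally show ?thesis .
qed

lemma \<Phi>'_strict_decreasing: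
  assumes s: "s \<in> {0..1}" and t: "t \<in> {0..1}" and "s < t"
  shows "\<Phi>' t < \<Phi>' s"
  unfolding \<Phi>'_def
proof (rule integral_less_AE_space)
  show "AE \<omega> in \<Omega>. W\<^sub>2 \<omega> * ((V \<omega> + W\<^sub>1 \<omega>) * t powr (1 / k) + W\<^sub>2 \<omega>) powr (- k - 1)
     < W\<^sub>2 \<omega> * ((V \<omega> + W\<^sub>1 \<omega>) * s powr (1 / k) + W\<^sub>2 \<omega>) powr (- k - 1)"
    using AE_pos
    by eventually_elim (rule perspective_deriv_strict_decreasing, use k s \<open>s < t\<close> in auto)
qed (use integrable_\<Phi>'[OF s] integrable_\<Phi>'[OF t] in \<open>auto simp: emeasure_space_1\<close>)

lemma continuous_\<Phi>': "continuous_on {0..1} \<Phi>'"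
  unfolding continuous_on_sequentially
proof (intro allI ballI impI, elim conjE)
  fix u :: "nat \<Rightarrow> real" and t assume u: "\<forall>n. u n \<in> {0..1}" "u \<longlonglongrightarrow> t" and t: "t \<in> {0..1}"
  show "(\<Phi>' \<circ> u) \<longlonglongrightarrow> \<Phi>' t"
    unfolding comp_def \<Phi>'_def
  proof (rule integral_dominated_convergence[OF _ _ integrable_W2])
    show "AE \<omega> in \<Omega>. (\<lambda>n. W\<^sub>2 \<omega> * ((V \<omega> + W\<^sub>1 \<omega>) * u n powr (1 / k) + W\<^sub>2 \<omega>) powr (- k - 1))
      \<longlonglongrightarrow> W\<^sub>2 \<omega> * ((V \<omega> + W\<^sub>1 \<omega>) * t powr (1 / k) + W\<^sub>2 \<omega>) powr (- k - 1)"
      using AE_pos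
    proof eventually_elim
      case (elim \<omega>)
      have "(\<lambda>n. u n powr (1 / k)) \<longlonglongrightarrow> t powr (1 / k)"
        using u t k by (intro tendsto_powr2) auto
      then have lim: "(\<lambda>n. (V \<omega> + W\<^sub>1 \<omega>) * u n powr (1 / k) + W\<^sub>2 \<omega>) \<longlonglongrightarrow> (V \<omega> + W\<^sub>1 \<omega>) * t powr (1 / k) + W\<^sub>2 \<omega>"
        by (intro tendsto_add tendsto_mult tendsto_const)
      have "0 < (V \<omega> + W\<^sub>1 \<omega>) * t powr (1 / k) + W\<^sub>2 \<omega>"
        using elim by (simp add: add_nonneg_pos)
      then show ?case
        by (intro tendsto_mult tendsto_const tendsto_powr[OF lim]) simp
    qed
    show "AE \<omega> in \<Omega>. norm (W\<^sub>2 \<omega> * ((V \<omega> + W\<^sub>1 \<omega>) * u n powr (1 / k) + W\<^sub>2 \<omega>) powr (- k - 1)) \<le> W\<^sub>2 \<omega> powr - k" for n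
      using u by (intro AE_\<Phi>'_bound) auto
  qed measurable
qed

lemma expectation_swap_W:
  fixes f :: "real \<times> real \<Rightarrow> real"
  assumes [measurable]: "f \<in> borel_measurable (borel \<Otimes>\<^sub>M borel)"
  shows "expectation (\<lambda>\<omega>. f (W\<^sub>1 \<omega>, W\<^sub>2 \<omega>)) = expectation (\<lambda>\<omega>. f (W\<^sub>2 \<omega>, W\<^sub>1 \<omega>))"
proof -
  have [measurable_cong]: "sets H = sets borel" by (simp flip: distr(2))
  interpret H: prob_space H unfolding distr(2)[symmetric] by (rule prob_space_distr) measurable
  interpret HH: pair_sigma_finite H H ..
  have "expectation (\<lambda>\<omega>. f (W\<^sub>1 \<omega>, W\<^sub>2 \<omega>)) = integral\<^sup>L (H \<Otimes>\<^sub>M H) f"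
    unfolding distr_W[symmetric] by (rule integral_distr[symmetric]) measurable
  also have "\<dots> = integral\<^sup>L (H \<Otimes>\<^sub>M H) (\<lambda>(x, y). f (y, x))"
    by (rule HH.integral_product_swap[symmetric]) measurable
  also have "\<dots> = expectation (\<lambda>\<omega>. f (W\<^sub>2 \<omega>, W\<^sub>1 \<omega>))"
    unfolding distr_W[symmetric] by (subst integral_distr) simp_all
  finally show ?thesis .
qed

text \<open>
  At \<open>t = 0\<close> the variables \<open>V\<close> and \<open>W\<^sub>1\<close> drop out and \<open>\<Phi>' 0\<close> is the moment \<open>E[W\<^sub>2\<^sup>-\<^sup>k]\<close>, which exceeds
  \<open>E[(W\<^sub>1 + W\<^sub>2)\<^sup>-\<^sup>k]\<close>.
\<close>

lemma N_less_\<Phi>'_0: "N < \<Phi>' 0"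
  unfolding N_def \<Phi>'_def
proof (rule integral_less_AE_space)
  show "AE \<omega> in \<Omega>. (W\<^sub>1 \<omega> + W\<^sub>2 \<omega>) powr - k < W\<^sub>2 \<omega> * ((V \<omega> + W\<^sub>1 \<omega>) * 0 powr (1 / k) + W\<^sub>2 \<omega>) powr (- k - 1)"
    using AE_pos
  proof eventually_elim
    case (elim \<omega>)
    then have "(W\<^sub>1 \<omega> + W\<^sub>2 \<omega>) powr - k < W\<^sub>2 \<omega> powr - k"
      using k by (intro powr_less_mono2_neg) auto
    then show ?case using elim by (simp add: powr_diff)
  qed
qed (use integrable_W integrable_\<Phi>'[of 0] in \<open>auto simp: emeasure_space_1\<close>)

lemma N_pos: "0 < N"
proof -
  have "expectation (\<lambda>\<omega>. 0) < N"
    unfolding N_def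
  proof (rule integral_less_AE_space)
    show "AE \<omega> in \<Omega>. 0 < (W\<^sub>1 \<omega> + W\<^sub>2 \<omega>) powr - k"
      using AE_pos by eventually_elim simp
  qed (use integrable_W in \<open>auto simp: emeasure_space_1\<close>)
  then show ?thesis by simp
qed

text \<open>
  Dropping \<open>V > 0\<close> from the denominator gives \<open>\<Phi>' 1 < E[W\<^sub>2 (W\<^sub>1 + W\<^sub>2)\<^sup>-\<^sup>k\<^sup>-\<^sup>1]\<close>, and by exchangeability of
  \<open>W\<^sub>1\<close> and \<open>W\<^sub>2\<close> twice the latter is \<open>E[(W\<^sub>1 + W\<^sub>2) (W\<^sub>1 + W\<^sub>2)\<^sup>-\<^sup>k\<^sup>-\<^sup>1]\<close>.
\<close>

lemma \<Phi>'_1_less_N: "2 * \<Phi>' 1 < N"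
proof -
  let ?f = "\<lambda>(x, y). y * (x + y) powr (- k - 1) :: real"
  have int: "integrable \<Omega> (\<lambda>\<omega>. W\<^sub>1 \<omega> * (W\<^sub>1 \<omega> + W\<^sub>2 \<omega>) powr (- k - 1))"
     "integrable \<Omega> (\<lambda>\<omega>. W\<^sub>2 \<omega> * (W\<^sub>1 \<omega> + W\<^sub>2 \<omega>) powr (- k - 1))"
  proof -
    have bound: "x * (x + y) powr (- k - 1) \<le> (x + y) powr - k" if "0 < x" "0 < y" for x y
    proof -
      have "x * (x + y) powr (- k - 1) \<le> (x + y) * (x + y) powr (- k - 1)"
        using that by (intro mult_right_mono) auto
      then show ?thesis using that by (simp add: powr_diff)
    qed
    show "integrable \<Omega> (\<lambda>\<omega>. W\<^sub>1 \<omega> * (W\<^sub>1 \<omega> + W\<^sub>2 \<omega>) powr (- k - 1))"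
    proof (rule Bochner_Integration.integrable_bound[OF integrable_W])
      show "AE \<omega> in \<Omega>. norm (W\<^sub>1 \<omega> * (W\<^sub>1 \<omega> + W\<^sub>2 \<omega>) powr (- k - 1)) \<le> norm ((W\<^sub>1 \<omega> + W\<^sub>2 \<omega>) powr - k)"
        using AE_pos by eventually_elim (use bound in auto)
    qed measurable
    show "integrable \<Omega> (\<lambda>\<omega>. W\<^sub>2 \<omega> * (W\<^sub>1 \<omega> + W\<^sub>2 \<omega>) powr (- k - 1))"
    proof (rule Bochner_Integration.integrable_bound[OF integrable_W])
      show "AE \<omega> in \<Omega>. norm (W\<^sub>2 \<omega> * (W\<^sub>1 \<omega> + W\<^sub>2 \<omega>) powr (- k - 1)) \<le> norm ((W\<^sub>1 \<omega> + W\<^sub>2 \<omega>) powr - k)"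
        using AE_pos by eventually_elim (use bound[of "W\<^sub>2 _" "W\<^sub>1 _"] in \<open>auto simp: add.commute\<close>)
    qed measurable
  qed
  have "\<Phi>' 1 < expectation (\<lambda>\<omega>. W\<^sub>2 \<omega> * (W\<^sub>1 \<omega> + W\<^sub>2 \<omega>) powr (- k - 1))"
    unfolding \<Phi>'_def
  proof (rule integral_less_AE_space)
    show "AE \<omega> in \<Omega>. W\<^sub>2 \<omega> * ((V \<omega> + W\<^sub>1 \<omega>) * 1 powr (1 / k) + W\<^sub>2 \<omega>) powr (- k - 1)
      < W\<^sub>2 \<omega> * (W\<^sub>1 \<omega> + W\<^sub>2 \<omega>) powr (- k - 1)"
      using AE_pos
      by eventually_elim (use k in \<open>auto intro!: mult_strict_left_mono powr_less_mono2_neg\<close>)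
  qed (use int integrable_\<Phi>'[of 1] in \<open>auto simp: emeasure_space_1\<close>)
  moreover have "expectation (\<lambda>\<omega>. W\<^sub>1 \<omega> * (W\<^sub>1 \<omega> + W\<^sub>2 \<omega>) powr (- k - 1))
    = expectation (\<lambda>\<omega>. W\<^sub>2 \<omega> * (W\<^sub>1 \<omega> + W\<^sub>2 \<omega>) powr (- k - 1))"
    using expectation_swap_W[of ?f] by (simp add: add.commute)
  moreover have "N = expectation (\<lambda>\<omega>. W\<^sub>1 \<omega> * (W\<^sub>1 \<omega> + W\<^sub>2 \<omega>) powr (- k - 1) + W\<^sub>2 \<omega> * (W\<^sub>1 \<omega> + W\<^sub>2 \<omega>) powr (- k - 1))"
    unfolding N_def
  proof (rule integral_cong_AE)
    show "AE \<omega> in \<Omega>. (W\<^sub>1 \<omega> + W\<^sub>2 \<omega>) powr - k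
      = W\<^sub>1 \<omega> * (W\<^sub>1 \<omega> + W\<^sub>2 \<omega>) powr (- k - 1) + W\<^sub>2 \<omega> * (W\<^sub>1 \<omega> + W\<^sub>2 \<omega>) powr (- k - 1)"
      using AE_pos
    proof eventually_elim
      case (elim \<omega>)
      then have "(W\<^sub>1 \<omega> + W\<^sub>2 \<omega>) powr - k = (W\<^sub>1 \<omega> + W\<^sub>2 \<omega>) * (W\<^sub>1 \<omega> + W\<^sub>2 \<omega>) powr (- k - 1)"
        by (simp add: powr_diff)
      then show ?case by (simp only: distrib_right)
    qed
  qed measurable
  ultimately show ?thesis using int by simp
qed

end

text \<open>
  Here \<open>t\<^sup>1\<^sup>/\<^sup>k = c\<^sup>-\<^sup>2\<close>, so the base is \<open>(A + c\<^sup>2 W) / c\<^sup>2\<close>, and the factor \<open>c\<^sup>2\<^sup>k\<close> from its power cancels \<open>t\<close>.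
  Taking expectations turns the moments of the theorem into \<open>\<Phi>\<close> and \<open>\<Phi>'\<close>.
\<close>

lemma perspective_at_scale:
  fixes A W c k :: real
  assumes "0 < A" "0 < W" "0 < c" "0 < k"
  defines "t \<equiv> c powr (- 2 * k)"
  shows "t * (A * t powr (1 / k) + W) powr - k = (A + c\<^sup>2 * W) powr - k"
    and "W * (A * t powr (1 / k) + W) powr (- k - 1) = c powr (2 * k + 2) * (W / (A + c\<^sup>2 * W) powr (k + 1))"
proof -
  have "t powr (1 / k) = c powr - 2"
    using assms by (simp add: t_def powr_powr)
  also have "\<dots> = 1 / c\<^sup>2"
    using assms by (simp add: powr_minus_divide)
  finally have base: "A * t powr (1 / k) + W = (A + c\<^sup>2 * W) / c\<^sup>2"
    using assms by (simp add: field_simps)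
  have pos: "0 < A + c\<^sup>2 * W" using assms by (simp add: add_pos_pos)
  have scale: "(c\<^sup>2) powr x = c powr (2 * x)" for x
  proof -
    have "(c\<^sup>2) powr x = (c powr 2) powr x" using assms by simp
    then show ?thesis by (simp only: powr_powr)
  qed
  show "t * (A * t powr (1 / k) + W) powr - k = (A + c\<^sup>2 * W) powr - k"
    unfolding base using pos assms by (simp add: powr_divide scale t_def)
  show "W * (A * t powr (1 / k) + W) powr (- k - 1) = c powr (2 * k + 2) * (W / (A + c\<^sup>2 * W) powr (k + 1))"
  proof -
    have "((A + c\<^sup>2 * W) / c\<^sup>2) powr (- k - 1) = 1 / ((A + c\<^sup>2 * W) / c\<^sup>2) powr (k + 1)"
      using powr_minus_divide[of "(A + c\<^sup>2 * W) / c\<^sup>2" "k + 1"] by simp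
    also have "\<dots> = c powr (2 * k + 2) / (A + c\<^sup>2 * W) powr (k + 1)"
      using pos assms by (simp add: powr_divide scale algebra_simps)
    finally show ?thesis unfolding base by simp
  qed
qed

context mixing_variables
begin

lemma \<Phi>_at_scale:
  assumes c: "0 < c"
  shows "\<Phi> (c powr (- 2 * k)) = expectation (\<lambda>\<omega>. (V \<omega> + W\<^sub>1 \<omega> + c\<^sup>2 * W\<^sub>2 \<omega>) powr - k)"
  unfolding \<Phi>_def
proof (rule integral_cong_AE)
  show "AE \<omega> in \<Omega>. c powr (- 2 * k) * ((V \<omega> + W\<^sub>1 \<omega>) * (c powr (- 2 * k)) powr (1 / k) + W\<^sub>2 \<omega>) powr - k
    = (V \<omega> + W\<^sub>1 \<omega> + c\<^sup>2 * W\<^sub>2 \<omega>) powr - k"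
    using AE_pos by eventually_elim (rule perspective_at_scale, use c k in auto)
qed measurable

lemma \<Phi>'_at_scale:
  assumes c: "0 < c"
  shows "\<Phi>' (c powr (- 2 * k))
    = c powr (2 * k + 2) * expectation (\<lambda>\<omega>. W\<^sub>2 \<omega> / (V \<omega> + W\<^sub>1 \<omega> + c\<^sup>2 * W\<^sub>2 \<omega>) powr (k + 1))"
  unfolding \<Phi>'_def integral_mult_right_zero[symmetric]
proof (rule integral_cong_AE)
  show "AE \<omega> in \<Omega>. W\<^sub>2 \<omega> * ((V \<omega> + W\<^sub>1 \<omega>) * (c powr (- 2 * k)) powr (1 / k) + W\<^sub>2 \<omega>) powr (- k - 1)
    = c powr (2 * k + 2) * (W\<^sub>2 \<omega> / (V \<omega> + W\<^sub>1 \<omega> + c\<^sup>2 * W\<^sub>2 \<omega>) powr (k + 1))"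
    using AE_pos by eventually_elim (rule perspective_at_scale, use c k in auto)
qed measurable

lemma integrable_at_scale:
  assumes c: "1 \<le> c"
  shows "integrable \<Omega> (\<lambda>\<omega>. (V \<omega> + W\<^sub>1 \<omega> + c\<^sup>2 * W\<^sub>2 \<omega>) powr - k)"
proof (rule Bochner_Integration.integrable_bound[OF integrable_W2])
  show "AE \<omega> in \<Omega>. norm ((V \<omega> + W\<^sub>1 \<omega> + c\<^sup>2 * W\<^sub>2 \<omega>) powr - k) \<le> norm (W\<^sub>2 \<omega> powr - k)"
    using AE_pos
  proof eventually_elim
    case (elim \<omega>)
    have "1 * W\<^sub>2 \<omega> \<le> c\<^sup>2 * W\<^sub>2 \<omega>" using elim c by (intro mult_right_mono) auto
    then have "W\<^sub>2 \<omega> \<le> V \<omega> + W\<^sub>1 \<omega> + c\<^sup>2 * W\<^sub>2 \<omega>" using elim by linarith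
    then show ?case using elim k by (auto intro!: powr_mono2')
  qed
qed measurable

lemma nn_integral_gauss_0:
  assumes k_eq: "k = real DIM('a::euclidean_space) / 2"
    and [measurable]: "f \<in> borel_measurable \<Omega>" and f: "AE \<omega> in \<Omega>. 0 < f \<omega>"
    and int: "integrable \<Omega> (\<lambda>\<omega>. f \<omega> powr - k)"
  shows "(\<integral>\<^sup>+\<omega>. ennreal (gauss (f \<omega>) (0::'a)) \<partial>\<Omega>) = ennreal ((2 * pi) powr - k * expectation (\<lambda>\<omega>. f \<omega> powr - k))"
proof -
  have "(\<integral>\<^sup>+\<omega>. ennreal (gauss (f \<omega>) (0::'a)) \<partial>\<Omega>) = (\<integral>\<^sup>+\<omega>. ennreal ((2 * pi) powr - k * f \<omega> powr - k) \<partial>\<Omega>)"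
    using f by (intro nn_integral_cong_AE, eventually_elim) (simp add: gauss_def k_eq powr_mult)
  also have "\<dots> = ennreal (expectation (\<lambda>\<omega>. (2 * pi) powr - k * f \<omega> powr - k))"
    using int by (intro nn_integral_eq_integral) auto
  finally show ?thesis by simp
qed

lemma normal_mixture_HH_0:
  assumes k_eq: "k = real DIM('a::euclidean_space) / 2" and b: "0 < b"
  shows "normal_mixture (H \<Otimes>\<^sub>M H) (\<lambda>(w, w'). b * w + b * w') (0::'a) = ennreal ((2 * pi) powr - k * (b powr - k * N))"
proof -
  have scale: "AE \<omega> in \<Omega>. (b * W\<^sub>1 \<omega> + b * W\<^sub>2 \<omega>) powr - k = b powr - k * (W\<^sub>1 \<omega> + W\<^sub>2 \<omega>) powr - k"
    using AE_pos
  proof eventually_elim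
    case (elim \<omega>)
    then show ?case using b by (simp add: distrib_left[symmetric] powr_mult)
  qed
  have "normal_mixture (H \<Otimes>\<^sub>M H) (\<lambda>(w, w'). b * w + b * w') (0::'a)
    = (\<integral>\<^sup>+\<omega>. ennreal (gauss (b * W\<^sub>1 \<omega> + b * W\<^sub>2 \<omega>) (0::'a)) \<partial>\<Omega>)"
    unfolding normal_mixture_def distr_W[symmetric] by (subst nn_integral_distr) (simp_all add: case_prod_beta)
  also have "\<dots> = ennreal ((2 * pi) powr - k * expectation (\<lambda>\<omega>. (b * W\<^sub>1 \<omega> + b * W\<^sub>2 \<omega>) powr - k))"
  proof (rule nn_integral_gauss_0[OF k_eq])
    show "AE \<omega> in \<Omega>. 0 < b * W\<^sub>1 \<omega> + b * W\<^sub>2 \<omega>"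
      using AE_pos by eventually_elim (use b in \<open>simp add: add_pos_pos\<close>)
    have "integrable \<Omega> (\<lambda>\<omega>. b powr - k * (W\<^sub>1 \<omega> + W\<^sub>2 \<omega>) powr - k)" using integrable_W by simp
    then show "integrable \<Omega> (\<lambda>\<omega>. (b * W\<^sub>1 \<omega> + b * W\<^sub>2 \<omega>) powr - k)"
      using scale by (subst integrable_cong_AE) auto
  qed measurable
  also have "expectation (\<lambda>\<omega>. (b * W\<^sub>1 \<omega> + b * W\<^sub>2 \<omega>) powr - k) = b powr - k * N"
    unfolding N_def integral_mult_right_zero[symmetric]
    by (rule integral_cong_AE) (use scale in auto)
  finally show ?thesis .
qed

lemma normal_mixture_GHH_0:
  assumes k_eq: "k = real DIM('a::euclidean_space) / 2" and c: "1 \<le> c"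
  shows "normal_mixture (G \<Otimes>\<^sub>M (H \<Otimes>\<^sub>M H)) (\<lambda>(v, w). v + (case w of (w, w') \<Rightarrow> w + c\<^sup>2 * w')) (0::'a)
    = ennreal ((2 * pi) powr - k * \<Phi> (c powr (- 2 * k)))"
proof -
  have c0: "0 < c" using c by simp
  have "normal_mixture (G \<Otimes>\<^sub>M (H \<Otimes>\<^sub>M H)) (\<lambda>(v, w). v + (case w of (w, w') \<Rightarrow> w + c\<^sup>2 * w')) (0::'a)
    = (\<integral>\<^sup>+\<omega>. ennreal (gauss (V \<omega> + W\<^sub>1 \<omega> + c\<^sup>2 * W\<^sub>2 \<omega>) (0::'a)) \<partial>\<Omega>)"
    unfolding normal_mixture_def distr_VW[symmetric]
    by (subst nn_integral_distr) (simp_all add: case_prod_beta add.assoc)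
  also have "\<dots> = ennreal ((2 * pi) powr - k * expectation (\<lambda>\<omega>. (V \<omega> + W\<^sub>1 \<omega> + c\<^sup>2 * W\<^sub>2 \<omega>) powr - k))"
  proof (rule nn_integral_gauss_0[OF k_eq _ _ integrable_at_scale[OF c]])
    show "AE \<omega> in \<Omega>. 0 < V \<omega> + W\<^sub>1 \<omega> + c\<^sup>2 * W\<^sub>2 \<omega>"
      using AE_pos by eventually_elim (use c in \<open>simp add: add_pos_pos\<close>)
  qed measurable
  finally show ?thesis unfolding \<Phi>_at_scale[OF c0] .
qed

end

section \<open>Risk comparison\<close>

theorem theorem4p2:
  fixes G H :: "real measure"
    and P :: "'a::euclidean_space \<Rightarrow> 's measure" and X :: "'s \<Rightarrow> 'a"
    and \<Omega> :: "'w measure" and V\<^sub>1 W\<^sub>1 W\<^sub>2 :: "'w \<Rightarrow> real"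
    and q :: "'a \<Rightarrow> real" and R :: "'a \<Rightarrow> ('a \<Rightarrow> 'a \<Rightarrow> real) \<Rightarrow> ennreal"
    and M :: "real \<Rightarrow> real" and N :: real
  assumes G: "mixing_law G" "integrable G (\<lambda>v. v powr (- real DIM('a) / 2))"
    and H: "mixing_law H" "integrable H (\<lambda>w. w powr (- real DIM('a) / 2))"
    and q: "q = sn_density H"
    and X: "\<And>\<mu>. prob_space (P \<mu>)"
      "\<And>\<mu>. distributed (P \<mu>) lborel (\<lambda>s. X s - \<mu>) (\<lambda>x. ennreal (sn_density G x))"
    and R: "R = l2_risk P X q"
    and \<Omega>: "prob_space \<Omega>"
      "prob_space.indep_vars \<Omega> (\<lambda>_. borel) (\<lambda>i. [V\<^sub>1, W\<^sub>1, W\<^sub>2] ! i) {..<3}"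
      "distr \<Omega> borel V\<^sub>1 = G" "distr \<Omega> borel W\<^sub>1 = H" "distr \<Omega> borel W\<^sub>2 = H"
    and M: "\<And>c. c \<ge> 1 \<Longrightarrow>
      M c = (\<integral>\<omega>. (V\<^sub>1 \<omega> + W\<^sub>1 \<omega> + c\<^sup>2 * W\<^sub>2 \<omega>) powr (- real DIM('a) / 2) \<partial>\<Omega>)"
    and N: "N = (\<integral>\<omega>. (W\<^sub>1 \<omega> + W\<^sub>2 \<omega>) powr (- real DIM('a) / 2) \<partial>\<Omega>)"
  shows
    "(\<forall>c\<ge>1. \<forall>\<mu>. R \<mu> (qhat q c) < \<infinity> \<and>
        enn2real (R \<mu> (qhat q c)) =
          1 / (2 * pi) powr (real DIM('a) / 2) * ((1 + 1 / c ^ DIM('a)) * N - 2 * M c))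
     \<and>
     (let critical = (\<lambda>c. c > 1 \<and>
            2 * c ^ (DIM('a) + 2) *
              (\<integral>\<omega>. W\<^sub>2 \<omega> / (V\<^sub>1 \<omega> + W\<^sub>1 \<omega> + c\<^sup>2 * W\<^sub>2 \<omega>) powr (real DIM('a) / 2 + 1) \<partial>\<Omega>) = N)
      in (\<exists>!c. critical c) \<and>
         (\<forall>cs. critical cs \<longrightarrow>
            (\<forall>qh. optimal_among R {qhat q c | c. c \<ge> 1} qh \<longleftrightarrow> qh = qhat q cs)))
     \<and>
     (let boundary = (\<lambda>c. c > 1 \<and> N * (1 - 1 / c ^ DIM('a)) = 2 * (M 1 - M c))
      in (N \<ge> 2 * M 1 \<longrightarrow> (\<forall>c>1. dominates R (qhat q c) (qhat q 1))) \<and>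
         (\<not> N \<ge> 2 * M 1 \<longrightarrow>
            (\<exists>!c. boundary c) \<and>
            (\<forall>c\<^sub>1. boundary c\<^sub>1 \<longrightarrow>
               (\<forall>c. 1 < c \<and> c < c\<^sub>1 \<longrightarrow> dominates R (qhat q c) (qhat q 1)))))"
proof -
  define k where "k = real DIM('a) / 2"
  have k: "0 < k" by (simp add: k_def)
  have minus_k: "- real DIM('a) / 2 = - k" by (simp add: k_def)
  interpret mv: mixing_variables \<Omega> V\<^sub>1 W\<^sub>1 W\<^sub>2 G H k
    using G(1) H(1) H(2)[unfolded minus_k] \<Omega> k
    by (intro mixing_variables.intro mixing_variables_axioms.intro) (auto intro: mixing_law_pos)
  have N': "N = mv.N" unfolding N mv.N_def minus_k ..
  \<comment> \<open>Under \<open>\<tau>\<close> the scales \<open>c \<ge> 1\<close> correspond to the points of \<open>(0, 1]\<close>, in reverse order; \<open>0\<close> is \<open>c = \<infinity>\<close>.\<close>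
  define \<tau> where "\<tau> c = 1 / c ^ DIM('a)" for c :: real
  have \<tau>_powr: "\<tau> c = c powr (- 2 * k)" if "0 < c" for c
  proof -
    have "c powr (- 2 * k) = 1 / c powr real DIM('a)"
      by (simp add: k_def powr_minus_divide)
    then show ?thesis using that by (simp add: \<tau>_def powr_realpow)
  qed
  have \<tau>_1: "\<tau> 1 = 1" by (simp add: \<tau>_def)
  have \<tau>_range: "0 < \<tau> c" "\<tau> c \<le> 1" if "1 \<le> c" for c
    using that by (simp_all add: \<tau>_def)
  have \<tau>_less: "\<tau> c < \<tau> c'" if "1 \<le> c'" "c' < c" for c c'
  proof -
    have "c' ^ DIM('a) < c ^ DIM('a)" using that by (intro power_strict_mono) auto
    then show ?thesis using that by (simp add: \<tau>_def frac_less2)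
  qed
  have \<tau>_inj: "c = c'" if "1 \<le> c" "1 \<le> c'" "\<tau> c = \<tau> c'" for c c'
    using \<tau>_less[of c c'] \<tau>_less[of c' c] that by (cases c c' rule: linorder_cases) auto
  have \<tau>_surj: "\<exists>c>1. \<tau> c = t" if "0 < t" "t < 1" for t
  proof (intro exI conjI)
    let ?c = "t powr (- 1 / (2 * k))"
    have "1 powr (- 1 / (2 * k)) < ?c" using that k by (intro powr_less_mono2_neg) auto
    then show "1 < ?c" by simp
    then show "\<tau> ?c = t" using that k by (simp add: \<tau>_powr powr_powr)
  qed
  have M': "M c = mv.\<Phi> (\<tau> c)" if "1 \<le> c" for c
  proof -
    have "0 < c" using that by simp
    show ?thesis unfolding M[OF that] \<tau>_powr[OF \<open>0 < c\<close>] mv.\<Phi>_at_scale[OF \<open>0 < c\<close>] minus_k ..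
  qed
  have crit: "2 * c ^ (DIM('a) + 2) *
      (\<integral>\<omega>. W\<^sub>2 \<omega> / (V\<^sub>1 \<omega> + W\<^sub>1 \<omega> + c\<^sup>2 * W\<^sub>2 \<omega>) powr (real DIM('a) / 2 + 1) \<partial>\<Omega>) = 2 * mv.\<Phi>' (\<tau> c)"
    if "1 < c" for c
  proof -
    have "c powr (2 * k + 2) = c powr real (DIM('a) + 2)" by (simp add: k_def add.commute)
    also have "\<dots> = c ^ (DIM('a) + 2)" using that by (intro powr_realpow) simp
    finally have pow: "c powr (2 * k + 2) = c ^ (DIM('a) + 2)" .
    have "0 < c" using that by simp
    show ?thesis
      unfolding \<tau>_powr[OF \<open>0 < c\<close>] mv.\<Phi>'_at_scale[OF \<open>0 < c\<close>] pow k_def[symmetric] by (rule mult.assoc)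
  qed
  \<comment> \<open>Up to the factor \<open>C\<close>, \<open>F\<close> is the risk and \<open>E\<close> its derivative in \<open>t\<close>.\<close>
  define F where "F t = (1 + t) * N - 2 * mv.\<Phi> t" for t
  define E where "E t = N - 2 * mv.\<Phi>' t" for t
  define C where "C = 1 / (2 * pi) powr (real DIM('a) / 2)"
  have C: "0 < C" "C = (2 * pi) powr - k"
    by (simp_all add: C_def k_def powr_minus_divide)

  have risk: "R \<mu> (qhat q c) < \<infinity> \<and> enn2real (R \<mu> (qhat q c)) = C * F (\<tau> c)" if c: "1 \<le> c" for c \<mu>
  proof -
    have c0: "0 < c" using c by simp
    have "R \<mu> (qhat q c) + 2 * ennreal (C * mv.\<Phi> (\<tau> c)) = ennreal (C * N) + ennreal (C * (\<tau> c * N))"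
    proof -
      have c2: "(c\<^sup>2) powr - k = \<tau> c"
      proof -
        have "(c\<^sup>2) powr - k = (c powr 2) powr - k" using c0 by simp
        then show ?thesis unfolding \<tau>_powr[OF c0] by (simp add: powr_powr)
      qed
      have "normal_mixture (H \<Otimes>\<^sub>M H) (\<lambda>(w, w'). w + w') (0::'a) = ennreal (C * N)"
        using mv.normal_mixture_HH_0[OF k_def, of 1] by (simp add: C(2) N')
      moreover have "normal_mixture (H \<Otimes>\<^sub>M H) (\<lambda>(w, w'). c\<^sup>2 * w + c\<^sup>2 * w') (0::'a) = ennreal (C * (\<tau> c * N))"
        using mv.normal_mixture_HH_0[OF k_def, of "c\<^sup>2"] c0 unfolding c2 C(2) N' by simp
      ultimately show ?thesis
        using l2_risk_qhat[where P = P and X = X and \<mu> = \<mu>, OF G H X(1) X(2) c0]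
        unfolding mv.normal_mixture_GHH_0[OF k_def c] \<tau>_powr[OF c0, symmetric] C(2)[symmetric]
        by (simp add: R q)
    qed
    moreover have "0 \<le> mv.\<Phi> (\<tau> c)"
      unfolding mv.\<Phi>_def using \<tau>_range[OF c] by (intro Bochner_Integration.integral_nonneg) auto
    moreover have "0 < N" using mv.N_pos N' by simp
    ultimately have eq: "R \<mu> (qhat q c) + ennreal (2 * (C * mv.\<Phi> (\<tau> c))) = ennreal (C * N + C * (\<tau> c * N))"
      using C \<tau>_range[OF c] by (simp add: ennreal_mult' ennreal_plus)
    then have fin: "R \<mu> (qhat q c) < \<infinity>"
      by (metis ennreal_add_eq_top ennreal_neq_top infinity_ennreal_def top.not_eq_extremum)
    then obtain r where r: "R \<mu> (qhat q c) = ennreal r" "0 \<le> r"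
      by (cases "R \<mu> (qhat q c)") auto
    have "r + 2 * (C * mv.\<Phi> (\<tau> c)) = C * N + C * (\<tau> c * N)"
      using eq r C \<tau>_range[OF c] \<open>0 \<le> mv.\<Phi> (\<tau> c)\<close> \<open>0 < N\<close>
      by (simp add: ennreal_plus[symmetric] del: ennreal_plus)
    then show ?thesis using fin r by (simp add: F_def algebra_simps)
  qed
  have risk_eq: "R \<mu> (qhat q c) = ennreal (C * F (\<tau> c))" and F_nonneg: "0 \<le> C * F (\<tau> c)" if "1 \<le> c" for c \<mu>
    using risk[OF that, of \<mu>] by (metis ennreal_enn2real infinity_ennreal_def, metis enn2real_nonneg)
  have risk_le: "R \<mu> (qhat q c) \<le> R \<mu> (qhat q c') \<longleftrightarrow> F (\<tau> c) \<le> F (\<tau> c')" if "1 \<le> c" "1 \<le> c'" for c c' \<mu>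
    using that C F_nonneg by (simp add: risk_eq ennreal_le_iff)
  have dominates_iff: "dominates R (qhat q c) (qhat q c') \<longleftrightarrow> F (\<tau> c) < F (\<tau> c')" if "1 \<le> c" "1 \<le> c'" for c c'
    using risk_le[OF that] risk_le[OF that(2,1)] by (auto simp: dominates_def not_le[symmetric])

  obtain z where z: "0 < z" "z < 1" "E z = 0"
    and z_unique: "\<And>t. t \<in> {0..1} \<Longrightarrow> E t = 0 \<Longrightarrow> t = z"
    and z_min: "\<And>t. t \<in> {0..1} \<Longrightarrow> t \<noteq> z \<Longrightarrow> F z < F t"
    and below: "\<And>t. F 0 \<le> F 1 \<Longrightarrow> 0 < t \<Longrightarrow> t < 1 \<Longrightarrow> F t < F 1"
    and crossing: "F 1 < F 0 \<Longrightarrow> \<exists>r. 0 < r \<and> r < 1 \<and> F r = F 1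
       \<and> (\<forall>t. 0 < t \<longrightarrow> t < 1 \<longrightarrow> F t = F 1 \<longrightarrow> t = r) \<and> (\<forall>t. r < t \<longrightarrow> t < 1 \<longrightarrow> F t < F 1)"
  proof (rule strictly_convex_unit_interval[of E F])
    show "E t * (s - t) \<le> F s - F t" if "s \<in> {0..1}" "t \<in> {0..1}" for s t
      using mv.\<Phi>_slope[OF that] by (simp add: E_def F_def algebra_simps)
    show "E s < E t" if "s \<in> {0..1}" "t \<in> {0..1}" "s < t" for s t
      using mv.\<Phi>'_strict_decreasing[OF that] by (simp add: E_def)
    show "continuous_on {0..1} E"
      unfolding E_def using mv.continuous_\<Phi>' by (intro continuous_intros)
    show "E 0 < 0" "0 < E 1"
      using mv.N_less_\<Phi>'_0 mv.\<Phi>'_1_less_N mv.N_pos by (auto simp: E_def N')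
  qed blast

  have critical_iff: "(c > 1 \<and> 2 * c ^ (DIM('a) + 2) *
      (\<integral>\<omega>. W\<^sub>2 \<omega> / (V\<^sub>1 \<omega> + W\<^sub>1 \<omega> + c\<^sup>2 * W\<^sub>2 \<omega>) powr (real DIM('a) / 2 + 1) \<partial>\<Omega>) = N)
    \<longleftrightarrow> 1 < c \<and> \<tau> c = z" for c
  proof (cases "1 < c")
    case True
    have "N = 2 * mv.\<Phi>' (\<tau> c) \<longleftrightarrow> \<tau> c = z"
      using z(3) z_unique[of "\<tau> c"] \<tau>_range[of c] True by (auto simp: E_def)
    then show ?thesis unfolding crit[OF True] by auto
  qed simp
  have M1: "M 1 = mv.\<Phi> 1" by (simp add: M' \<tau>_1)
  have F_0: "F 0 = N" by (simp add: F_def mv.\<Phi>_def)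
  have F_1: "F 1 = 2 * N - 2 * M 1" by (simp add: F_def M1)
  have boundary_iff: "(c > 1 \<and> N * (1 - 1 / c ^ DIM('a)) = 2 * (M 1 - M c)) \<longleftrightarrow> 1 < c \<and> F (\<tau> c) = F 1" for c
    by (cases "1 < c") (auto simp: F_def M1 M' \<tau>_def[symmetric] algebra_simps)

  have risk_formula: "R \<mu> (qhat q c) < \<infinity> \<and> enn2real (R \<mu> (qhat q c)) =
      1 / (2 * pi) powr (real DIM('a) / 2) * ((1 + 1 / c ^ DIM('a)) * N - 2 * M c)" if "1 \<le> c" for c \<mu>
    using risk[OF that] that by (simp add: F_def C_def \<tau>_def[symmetric] M')

  have critical_unique: "\<exists>!c. 1 < c \<and> \<tau> c = z"
    using \<tau>_surj[OF z(1,2)] \<tau>_inj by (metis less_imp_le)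
  have optimal_iff: "optimal_among R {qhat q c | c. c \<ge> 1} qh \<longleftrightarrow> qh = qhat q cs" if cs: "1 < cs" "\<tau> cs = z" for cs qh
  proof
    assume opt: "optimal_among R {qhat q c | c. c \<ge> 1} qh"
    then obtain c where c: "1 \<le> c" "qh = qhat q c" by (auto simp: optimal_among_def)
    have "R \<mu> (qhat q c) \<le> R \<mu> (qhat q cs)" for \<mu>
      using opt cs unfolding c(2) optimal_among_def by fastforce
    then have "F (\<tau> c) \<le> F z" using risk_le[of c cs] c cs by simp
    then have "\<tau> c = z" using z_min[of "\<tau> c"] \<tau>_range[OF c(1)] by force
    then show "qh = qhat q cs" using \<tau>_inj[of c cs] c cs by simp
  next
    assume qh: "qh = qhat q cs"
    have "F z \<le> F (\<tau> c)" if "1 \<le> c" for c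
      using z_min[of "\<tau> c"] \<tau>_range[OF that] by (cases "\<tau> c = z") auto
    then show "optimal_among R {qhat q c | c. c \<ge> 1} qh"
      unfolding optimal_among_def qh using cs risk_le[of cs] by fastforce
  qed

  have dominates_always: "dominates R (qhat q c) (qhat q 1)" if "2 * M 1 \<le> N" "1 < c" for c
    using below[of "\<tau> c"] \<tau>_range[of c] \<tau>_less[of 1 c] that
    by (simp add: dominates_iff \<tau>_1 F_0 F_1)
  have dominates_below_root: "(\<exists>!c. 1 < c \<and> F (\<tau> c) = F 1) \<and>
      (\<forall>c\<^sub>1. 1 < c\<^sub>1 \<and> F (\<tau> c\<^sub>1) = F 1 \<longrightarrow> (\<forall>c. 1 < c \<and> c < c\<^sub>1 \<longrightarrow> dominates R (qhat q c) (qhat q 1)))"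
    if "\<not> 2 * M 1 \<le> N"
  proof -
    have "F 1 < F 0" using that by (simp add: F_0 F_1)
    then obtain r where r: "0 < r" "r < 1" "F r = F 1"
      and r_unique: "\<And>t. 0 < t \<Longrightarrow> t < 1 \<Longrightarrow> F t = F 1 \<Longrightarrow> t = r"
      and r_below: "\<And>t. r < t \<Longrightarrow> t < 1 \<Longrightarrow> F t < F 1"
      using crossing by blast
    obtain c\<^sub>0 where c0: "1 < c\<^sub>0" "\<tau> c\<^sub>0 = r" using \<tau>_surj[OF r(1,2)] by blast
    have in01: "0 < \<tau> c" "\<tau> c < 1" if "1 < c" for c
      using \<tau>_range[of c] \<tau>_less[of 1 c] that by (auto simp: \<tau>_1)
    have root: "c = c\<^sub>0" if "1 < c" "F (\<tau> c) = F 1" for c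
      using r_unique[OF in01[OF that(1)] that(2)] \<tau>_inj[of c c\<^sub>0] c0 that by simp
    have "dominates R (qhat q c) (qhat q 1)" if "1 < c" "c < c\<^sub>0" for c
      using r_below[of "\<tau> c"] in01[of c] \<tau>_less[of c c\<^sub>0] that c0 by (simp add: dominates_iff \<tau>_1)
    then show ?thesis using root c0 r(3) by metis
  qed
  show ?thesis
    unfolding Let_def critical_iff boundary_iff
    using risk_formula critical_unique optimal_iff dominates_always dominates_below_root by blast
qed

end
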